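(* Let $X$ be a locally compact Hausdorff space that is not compact. Consider the statements: (i) $X$ is metrizable, locally Euclidean, and has no isolated points; (ii) $X$ is metrizable and $\operatorname{Homeo}_{\overline U}(X)$ is not locally compact for every non-empty open set $U$ such that $\overline U$ is compact; (iii) $X$ is normal, locally metrizable, and contains (1) a compact subset $M_0$ such that $\operatorname{Homeo}_{M_0}(X)$ is not locally compact, and (2) an infinite discrete closed set $T$ such that for every $t\in T$ and every neighborhood $V$ of $t$ with compact closure, $\operatorname{Homeo}_{\overline V}(X)$ is not discrete; (iv) $X$ contains (1) a compact metrizable subset $M_0$ such that $\operatorname{Homeo}_{M_0}(X)$ is not locally compact, and (2) a regular closed, $\sigma$-compact, metrizable subset $A$ whose interior contains an infinite discrete closed set $T$ such that for every $t\in T$ and every neighborhood $V$ of $t$ with compact closure, $\operatorname{Homeo}_{\overline V}(X)$ is not discrete; (v) the family $\{\operatorname{Homeo}_K(X)\}_{K\in\mathscr K(X)}$ does not satisfy ACP. Then (i) $\Rightarrow$ (ii) $\Rightarrow$ (iii) $\Rightarrow$ (iv) $\Rightarrow$ (v).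
   Context: A space is locally Euclidean if every point has an open neighborhood homeomorphic to $\mathbb R^n$ for some $n$. A subset is regular closed if it equals the closure of its interior. For a compact subset $K$ of $X$, $\operatorname{Homeo}_K(X)$ denotes the group of homeomorphisms $h$ of $X$ with $h(x)=x$ for all $x\in X\setminus K$, with the compact-open topology (a topological group). $\mathscr K(X)$ is the set of compact subsets of $X$ ordered by inclusion, and the family has inclusions as bonding maps. For a directed family $\{G_\alpha\}$ of topological groups with inclusions that are closed embeddings as bonding maps and union $G$, the colimit space topology is $\mathscr T=\{U\subseteq G\mid U\cap G_\alpha\text{ open in }G_\alpha\ \forall\alpha\}$; the family satisfies ACP if $(G,\mathscr T)$ is a topological group (equivalently, $\mathscr T$ equals the finest group topology making all inclusions continuous). *)

theory Defs
  imports "HOL-Analysis.Analysis"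
begin

definition locally_euclidean_space :: "'a topology \<Rightarrow> bool" where
  "locally_euclidean_space X \<longleftrightarrow>
     (\<forall>x \<in> topspace X. \<exists>U n. openin X U \<and> x \<in> U \<and>
        subtopology X U homeomorphic_space Euclidean_space n)"

definition locally_metrizable_space :: "'a topology \<Rightarrow> bool" where
  "locally_metrizable_space X \<longleftrightarrow>
     (\<forall>x \<in> topspace X. \<exists>U. openin X U \<and> x \<in> U \<and> metrizable_space (subtopology X U))"

definition no_isolated_points :: "'a topology \<Rightarrow> bool" where
  "no_isolated_points X \<longleftrightarrow> (\<forall>x \<in> topspace X. \<not> openin X {x})"

definition neighbourhood_of :: "'a topology \<Rightarrow> 'a set \<Rightarrow> 'a \<Rightarrow> bool" where
  "neighbourhood_of X V x \<longleftrightarrow> V \<subseteq> topspace X \<and> (\<exists>W. openin X W \<and> x \<in> W \<and> W \<subseteq> V)"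

definition sigma_compact_in :: "'a topology \<Rightarrow> 'a set \<Rightarrow> bool" where
  "sigma_compact_in X A \<longleftrightarrow> (\<exists>C :: nat \<Rightarrow> 'a set. (\<forall>n. compactin X (C n)) \<and> A = (\<Union>n. C n))"

definition regular_closed_in :: "'a topology \<Rightarrow> 'a set \<Rightarrow> bool" where
  "regular_closed_in X A \<longleftrightarrow> X closure_of (X interior_of A) = A"

definition infinite_discrete_closed_in :: "'a topology \<Rightarrow> 'a set \<Rightarrow> bool" where
  "infinite_discrete_closed_in X T \<longleftrightarrow>
     closedin X T \<and> infinite T \<and> subtopology X T = discrete_topology T"

text \<open>Homeo_K(X): homeomorphisms of X fixing every point outside K (as functions on the whole
  type, they are the identity outside K, in particular outside topspace X).\<close>
definition Homeo :: "'a topology \<Rightarrow> 'a set \<Rightarrow> ('a \<Rightarrow> 'a) set" where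
  "Homeo X K = {h. homeomorphic_map X X h \<and> (\<forall>x. x \<notin> K \<longrightarrow> h x = x)}"

definition compact_open_topology :: "'a topology \<Rightarrow> ('a \<Rightarrow> 'a) set \<Rightarrow> ('a \<Rightarrow> 'a) topology" where
  "compact_open_topology X G =
     subtopology
       (topology_generated_by {{h. h ` C \<subseteq> U} | C U. compactin X C \<and> openin X U})
       G"

definition Homeo_top :: "'a topology \<Rightarrow> 'a set \<Rightarrow> ('a \<Rightarrow> 'a) topology" where
  "Homeo_top X K = compact_open_topology X (Homeo X K)"

definition colimit_topology :: "'i set \<Rightarrow> ('i \<Rightarrow> 'g topology) \<Rightarrow> 'g topology" where
  "colimit_topology I T =
     topology (\<lambda>U. U \<subseteq> (\<Union>i\<in>I. topspace (T i)) \<and> (\<forall>i\<in>I. openin (T i) (U \<inter> topspace (T i))))"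

text \<open>A topology on a group of bijections of the type, with composition as product and
  inverse function as inverse, makes it a topological group.\<close>
definition topological_group_of_maps :: "('a \<Rightarrow> 'a) topology \<Rightarrow> bool" where
  "topological_group_of_maps T \<longleftrightarrow>
     continuous_map (prod_topology T T) T (\<lambda>p. fst p \<circ> snd p) \<and>
     continuous_map T T (\<lambda>h. inv h)"

definition Homeo_family_ACP :: "'a topology \<Rightarrow> bool" where
  "Homeo_family_ACP X \<longleftrightarrow>
     topological_group_of_maps (colimit_topology {K. compactin X K} (Homeo_top X))"

end

theory Submission
  imports Defs
begin

text \<open>
  (iv) implies (v). For a compact metrizable \<open>K\<close> the group \<open>Homeo\<^sub>K(X)\<close> is regular and second
  countable, being a subspace of the compact-open topology over the compact metrizable space \<open>K\<close>.
  Hence every neighbourhood of the identity in \<open>Homeo\<close> of \<open>M\<^sub>0\<close> contains a sequence without cluster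
  point, and every non-discrete \<open>Homeo\<^sub>K(X)\<close> contains a sequence of non-trivial elements converging
  to the identity. Take a countable base \<open>B\<^sub>n\<close> at the identity of \<open>Homeo\<close> of \<open>M\<^sub>0\<close>, sequences
  \<open>x\<^sub>n\<^sub>m\<close> in \<open>B\<^sub>n\<close> without cluster point, and \<open>y\<^sub>n\<^sub>m\<close> converging to the identity for
  \<open>m \<rightarrow> \<infinity>\<close>, supported in compact sets \<open>K\<^sub>n\<close> that miss \<open>M\<^sub>0\<close> and form a locally finite family.
  If the colimit topology were a group topology, then \<open>x\<^sub>n\<^sub>m \<circ> y\<^sub>n\<^sub>m\<close> would have no cluster point
  for \<open>m \<rightarrow> \<infinity>\<close>, so the set of all these products would be closed, although it misses the identity
  and meets \<open>U \<circ> V\<close> for all neighbourhoods \<open>U\<close> and \<open>V\<close> of the identity.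

  (iii) implies (iv). A Tietze extension of \<open>t\<^sub>n \<mapsto> n\<close> gives a disjoint locally finite family of compact
  metrizable neighbourhoods of the points \<open>t\<^sub>n\<close>, whose union is \<open>A\<close>; metrizability follows from
  Urysohn's metrization theorem.

  (i) implies (ii). In a chart, the radial maps \<open>p \<mapsto> p / (1 + k (1 - |p|))\<close> of a small ball form a
  sequence of homeomorphisms near the identity that fix the centre and move every other interior point
  towards it, so no cluster point of the sequence is injective.
\<close>

section \<open>Cluster points of sequences\<close>

definition cluster_pointin :: "'a topology \<Rightarrow> (nat \<Rightarrow> 'a) \<Rightarrow> 'a \<Rightarrow> bool" where
  "cluster_pointin X x z \<longleftrightarrow>
     z \<in> topspace X \<and> (\<forall>U. openin X U \<and> z \<in> U \<longrightarrow> (\<exists>\<^sub>F n in sequentially. x n \<in> U))"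

lemma not_cluster_pointin:
  assumes "z \<in> topspace X" "\<not> cluster_pointin X x z"
  obtains U where "openin X U" "z \<in> U" "\<forall>\<^sub>F n in sequentially. x n \<notin> U"
  using assms by (auto simp: cluster_pointin_def not_frequently)

lemma compactin_finite_pointwise_cover:
  assumes "compactin X K" "\<And>x. x \<in> K \<Longrightarrow> openin X (U x) \<and> x \<in> U x"
  obtains F where "finite F" "F \<subseteq> K" "K \<subseteq> (\<Union>x\<in>F. U x)"
proof -
  have "\<exists>\<F>. finite \<F> \<and> \<F> \<subseteq> U ` K \<and> K \<subseteq> \<Union>\<F>"
    by (rule compactinD[OF assms(1)]) (use assms(2) in auto)
  then show ?thesis using that by (metis finite_subset_image)
qed

lemma compactin_imp_cluster_pointin:
  assumes "compactin X K" "\<And>n. x n \<in> K"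
  shows "\<exists>z\<in>K. cluster_pointin X x z"
proof (rule ccontr)
  assume "\<not> ?thesis"
  moreover have "K \<subseteq> topspace X"
    using assms(1) by (rule compactin_subset_topspace)
  ultimately have "\<forall>z\<in>K. \<exists>U. openin X U \<and> z \<in> U \<and> (\<forall>\<^sub>F n in sequentially. x n \<notin> U)"
    by (metis not_cluster_pointin subsetD)
  then obtain U where U: "\<And>z. z \<in> K \<Longrightarrow> openin X (U z) \<and> z \<in> U z \<and> (\<forall>\<^sub>F n in sequentially. x n \<notin> U z)"
    by metis
  obtain F where F: "finite F" "F \<subseteq> K" "K \<subseteq> (\<Union>z\<in>F. U z)"
    using compactin_finite_pointwise_cover[OF assms(1), of U] U by metis
  then have "\<forall>\<^sub>F n in sequentially. \<forall>z\<in>F. x n \<notin> U z"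
    using U by (intro eventually_ball_finite) auto
  then have "\<forall>\<^sub>F n in sequentially. x n \<notin> K"
    by (rule eventually_mono) (use F(3) in blast)
  then show False
    using assms(2) by simp
qed

lemma continuous_map_cluster_pointin:
  assumes "continuous_map X Y f" "cluster_pointin X x z"
  shows "cluster_pointin Y (f \<circ> x) (f z)"
  unfolding cluster_pointin_def
proof (intro conjI allI impI)
  have z: "z \<in> topspace X" using assms(2) by (simp add: cluster_pointin_def)
  then show "f z \<in> topspace Y" using assms(1) by (auto simp: continuous_map_def)
  fix U assume U: "openin Y U \<and> f z \<in> U"
  then have "openin X {a \<in> topspace X. f a \<in> U}"
    using openin_continuous_map_preimage[OF assms(1)] by blast
  then have "\<exists>\<^sub>F n in sequentially. x n \<in> {a \<in> topspace X. f a \<in> U}"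
    using assms(2) z U by (auto simp: cluster_pointin_def)
  then show "\<exists>\<^sub>F n in sequentially. (f \<circ> x) n \<in> U"
    by (rule frequently_elim1) simp
qed

lemma cluster_pointin_pairwise:
  assumes x: "cluster_pointin X x a" and y: "limitin Y y b sequentially"
  shows "cluster_pointin (prod_topology X Y) (\<lambda>n. (x n, y n)) (a, b)"
  unfolding cluster_pointin_def
proof (intro conjI allI impI)
  show "(a, b) \<in> topspace (prod_topology X Y)"
    using x y by (auto simp: cluster_pointin_def limitin_def)
  fix W assume "openin (prod_topology X Y) W \<and> (a, b) \<in> W"
  then obtain U V where UV: "openin X U" "openin Y V" "a \<in> U" "b \<in> V" "U \<times> V \<subseteq> W"
    by (metis openin_prod_topology_alt)
  have "\<exists>\<^sub>F n in sequentially. x n \<in> U"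
    using x UV(1,3) by (auto simp: cluster_pointin_def)
  moreover have "\<forall>\<^sub>F n in sequentially. y n \<in> V"
    using y UV(2,4) by (rule limitinD)
  ultimately have "\<exists>\<^sub>F n in sequentially. x n \<in> U \<and> y n \<in> V"
    by (rule frequently_eventually_frequently)
  then show "\<exists>\<^sub>F n in sequentially. (x n, y n) \<in> W"
    by (rule frequently_elim1) (use UV(5) in blast)
qed

lemma cluster_pointin_limitin_unique:
  assumes "Hausdorff_space X" "cluster_pointin X x a" "limitin X x b sequentially"
  shows "a = b"
proof (rule ccontr)
  assume "a \<noteq> b"
  moreover have "a \<in> topspace X" "b \<in> topspace X"
    using assms by (auto simp: cluster_pointin_def limitin_def)
  ultimately obtain U V where UV: "openin X U" "openin X V" "a \<in> U" "b \<in> V" "disjnt U V"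
    using assms(1) by (metis Hausdorff_space_def)
  have "\<exists>\<^sub>F n in sequentially. x n \<in> U \<and> x n \<in> V"
    using assms(2,3) UV
    by (intro frequently_eventually_frequently) (auto simp: cluster_pointin_def limitin_def)
  then show False
    using UV(5) by (auto simp: disjnt_iff dest: frequently_ex)
qed

lemma cluster_pointin_closedin:
  assumes "closedin X S" "\<And>n. x n \<in> S" "cluster_pointin X x z"
  shows "z \<in> S"
proof (rule ccontr)
  assume "z \<notin> S"
  moreover have "z \<in> topspace X"
    using assms(3) by (simp add: cluster_pointin_def)
  moreover have "openin X (topspace X - S)"
    using assms(1) by blast
  ultimately have "\<exists>\<^sub>F n in sequentially. x n \<in> topspace X - S"
    using assms(3) unfolding cluster_pointin_def by blast
  then show False
    using assms(2) by simp
qed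

lemma cluster_pointin_subtopology:
  assumes "\<And>n. x n \<in> S"
  shows "cluster_pointin (subtopology X S) x z \<longleftrightarrow> z \<in> S \<and> cluster_pointin X x z"
proof -
  have "(\<forall>V. openin (subtopology X S) V \<and> z \<in> V \<longrightarrow> (\<exists>\<^sub>F n in sequentially. x n \<in> V)) \<longleftrightarrow>
      (\<forall>U. openin X U \<and> z \<in> U \<inter> S \<longrightarrow> (\<exists>\<^sub>F n in sequentially. x n \<in> U \<inter> S))"
    unfolding openin_subtopology by metis
  then show ?thesis
    using assms by (auto simp: cluster_pointin_def)
qed

lemma closedin_range_no_cluster_pointin:
  assumes "t1_space X" and x: "\<And>n. x n \<in> topspace X" "\<And>z. \<not> cluster_pointin X x z"
  shows "closedin X (range x)"
  unfolding closedin_def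
proof
  show "range x \<subseteq> topspace X" using x(1) by blast
  show "openin X (topspace X - range x)"
  proof (subst openin_subopen, intro ballI)
    fix z assume z: "z \<in> topspace X - range x"
    then obtain U where U: "openin X U" "z \<in> U" "\<forall>\<^sub>F n in sequentially. x n \<notin> U"
      using x(2)[of z] not_cluster_pointin by (metis DiffD1)
    then have "finite {n. x n \<in> U}"
      by (simp add: cofinite_eq_sequentially[symmetric] eventually_cofinite)
    then have "finite (x ` {n. x n \<in> U})" by simp
    moreover have "U \<inter> range x = x ` {n. x n \<in> U}" by blast
    ultimately have "finite (U \<inter> range x)" by simp
    then have "closedin X (U \<inter> range x)"
      using assms(1) x(1) by (auto simp: t1_space_closedin_finite)
    then have "openin X (U - U \<inter> range x)"
      using U(1) by blast
    then show "\<exists>V. openin X V \<and> z \<in> V \<and> V \<subseteq> topspace X - range x"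
      using z U(2) openin_subset[OF U(1)] by (intro exI[of _ "U - U \<inter> range x"]) auto
  qed
qed

lemma Lindelof_noncompact_closed_imp_sequence:
  assumes "Lindelof_space X" "closedin X N" "\<not> compactin X N"
  obtains x :: "nat \<Rightarrow> 'a" where "range x \<subseteq> N" "\<And>z. \<not> cluster_pointin X x z"
proof -
  have "N \<subseteq> topspace X" using assms(2) by (rule closedin_subset)
  then have "\<exists>\<U>. (\<forall>U\<in>\<U>. openin X U) \<and> N \<subseteq> \<Union>\<U> \<and> \<not> (\<exists>\<F>. finite \<F> \<and> \<F> \<subseteq> \<U> \<and> N \<subseteq> \<Union>\<F>)"
    using assms(3) by (simp add: compactin_def)
  then obtain \<U> where \<U>: "\<forall>U\<in>\<U>. openin X U" "N \<subseteq> \<Union>\<U>"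
    "\<And>\<F>. finite \<F> \<Longrightarrow> \<F> \<subseteq> \<U> \<Longrightarrow> \<not> N \<subseteq> \<Union>\<F>"
    by metis
  have "Lindelof_space (subtopology X N)"
    using assms(1,2) by (rule Lindelof_space_closedin_subtopology)
  then obtain \<V> where \<V>: "countable \<V>" "\<V> \<subseteq> \<U>" "N \<subseteq> \<Union>\<V>"
    using \<U>(1,2) \<open>N \<subseteq> topspace X\<close> by (metis Lindelof_space_subtopology_subset)
  define V where "V = from_nat_into \<V>"
  have "\<V> \<noteq> {}" using \<V>(3) \<U>(3)[of "{}"] by auto
  then have V: "range V = \<V>"
    using \<V>(1) by (simp add: V_def)
  have "\<not> N \<subseteq> \<Union>(V ` {..m})" for m
    using \<V>(2) V by (intro \<U>(3)) auto
  then have "\<exists>y. y \<in> N \<and> y \<notin> \<Union>(V ` {..m})" for m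
    by blast
  then obtain x where x: "\<And>m. x m \<in> N" "\<And>m. x m \<notin> \<Union>(V ` {..m})"
    by metis
  have "\<not> cluster_pointin X x z" for z
  proof
    assume z: "cluster_pointin X x z"
    have "z \<in> N" using assms(2) x(1) z by (rule cluster_pointin_closedin)
    then obtain i where i: "z \<in> V i" using \<V>(3) V by auto
    have "openin X (V i)" using \<U>(1) \<V>(2) V by auto
    then have "\<exists>\<^sub>F m in sequentially. x m \<in> V i"
      using z i by (simp add: cluster_pointin_def)
    then obtain m where "m \<ge> i" "x m \<in> V i"
      by (auto simp: frequently_sequentially)
    then show False using x(2)[of m] by auto
  qed
  then show ?thesis using x(1) that by blast
qed

section \<open>Countability and metrization\<close>

lemma first_countable_decseq_base:
  assumes "first_countable X" "z \<in> topspace X"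
  obtains B :: "nat \<Rightarrow> 'a set" where "\<And>n. openin X (B n)" "\<And>n. z \<in> B n" "decseq B"
    "\<And>W. openin X W \<Longrightarrow> z \<in> W \<Longrightarrow> \<exists>n. B n \<subseteq> W"
proof -
  obtain \<B> where \<B>: "countable \<B>" "\<And>V. V \<in> \<B> \<Longrightarrow> openin X V"
    "\<And>U. openin X U \<Longrightarrow> z \<in> U \<Longrightarrow> \<exists>V\<in>\<B>. z \<in> V \<and> V \<subseteq> U"
    using assms unfolding first_countable_def by metis
  define \<C> where "\<C> = {V \<in> \<B>. z \<in> V}"
  have \<C>: "countable \<C>" "\<C> \<noteq> {}"
    using \<B>(1) \<B>(3)[OF openin_topspace assms(2)] by (auto simp: \<C>_def)
  define V where "V = from_nat_into \<C>"
  have V: "V n \<in> \<C>" for n using \<C> by (simp add: V_def from_nat_into)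
  define B where "B n = \<Inter>(V ` {..n})" for n
  show ?thesis
  proof
    show "openin X (B n)" for n
      unfolding B_def using V \<B>(2) by (intro openin_Inter) (auto simp: \<C>_def)
    show "z \<in> B n" for n unfolding B_def using V by (auto simp: \<C>_def)
    show "decseq B" unfolding B_def decseq_def by force
    fix W assume "openin X W" "z \<in> W"
    then obtain U where U: "U \<in> \<C>" "U \<subseteq> W" using \<B>(3) by (auto simp: \<C>_def)
    then obtain n where "V n = U" using \<C> by (metis V_def from_nat_into_surj)
    then show "\<exists>n. B n \<subseteq> W" using U(2) by (intro exI[of _ n]) (auto simp: B_def)
  qed
qed

lemma derived_set_of_imp_limitin_sequence:
  assumes "first_countable X" "z \<in> X derived_set_of S"
  obtains y where "range y \<subseteq> S - {z}" "limitin X y z sequentially"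
proof -
  have z: "z \<in> topspace X" using assms(2) by (simp add: in_derived_set_of)
  obtain B where B: "\<And>n. openin X (B n)" "\<And>n. z \<in> B n" "decseq B"
    "\<And>W. openin X W \<Longrightarrow> z \<in> W \<Longrightarrow> \<exists>n. B n \<subseteq> W"
    using first_countable_decseq_base[OF assms(1) z] by metis
  have "\<exists>w. w \<in> S - {z} \<and> w \<in> B n" for n
    using assms(2) B(1,2)[of n] unfolding in_derived_set_of by blast
  then obtain y where y: "\<And>n. y n \<in> S - {z}" "\<And>n. y n \<in> B n" by metis
  have "limitin X y z sequentially"
    unfolding limitin_sequentially
  proof (intro conjI allI impI z)
    fix W assume "openin X W \<and> z \<in> W"
    then obtain N where "B N \<subseteq> W" using B(4) by blast
    then show "\<exists>N. \<forall>n\<ge>N. y n \<in> W"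
      using y(2) B(3) unfolding decseq_def by (meson in_mono)
  qed
  then show ?thesis using y(1) by (intro that[of y]) auto
qed

lemma second_countable_open_cover:
  assumes "countable \<U>" and op: "\<And>U. U \<in> \<U> \<Longrightarrow> openin X U"
    and sc: "\<And>U. U \<in> \<U> \<Longrightarrow> second_countable (subtopology X U)"
    and cov: "topspace X \<subseteq> \<Union>\<U>"
  shows "second_countable X"
proof -
  have "\<forall>U\<in>\<U>. \<exists>\<B>. countable \<B> \<and> (\<forall>V\<in>\<B>. openin X V) \<and>
      (\<forall>W x. openin X W \<and> W \<subseteq> U \<and> x \<in> W \<longrightarrow> (\<exists>V\<in>\<B>. x \<in> V \<and> V \<subseteq> W))"
  proof
    fix U assume "U \<in> \<U>"
    from sc[OF this] show "\<exists>\<B>. countable \<B> \<and> (\<forall>V\<in>\<B>. openin X V) \<and>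
        (\<forall>W x. openin X W \<and> W \<subseteq> U \<and> x \<in> W \<longrightarrow> (\<exists>V\<in>\<B>. x \<in> V \<and> V \<subseteq> W))"
      unfolding second_countable_def openin_open_subtopology[OF op[OF \<open>U \<in> \<U>\<close>]] by metis
  qed
  from bchoice[OF this] obtain \<B> where "\<forall>U\<in>\<U>. countable (\<B> U) \<and> (\<forall>V\<in>\<B> U. openin X V) \<and>
      (\<forall>W x. openin X W \<and> W \<subseteq> U \<and> x \<in> W \<longrightarrow> (\<exists>V\<in>\<B> U. x \<in> V \<and> V \<subseteq> W))"
    ..
  then have \<B>: "\<And>U. U \<in> \<U> \<Longrightarrow> countable (\<B> U)" "\<And>U V. U \<in> \<U> \<Longrightarrow> V \<in> \<B> U \<Longrightarrow> openin X V"
    "\<And>U W x. U \<in> \<U> \<Longrightarrow> openin X W \<Longrightarrow> W \<subseteq> U \<Longrightarrow> x \<in> W \<Longrightarrow> \<exists>V\<in>\<B> U. x \<in> V \<and> V \<subseteq> W"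
    by auto
  show ?thesis
    unfolding second_countable_def
  proof (intro exI[of _ "\<Union>(\<B> ` \<U>)"] conjI allI impI ballI)
    show "countable (\<Union>(\<B> ` \<U>))" using assms(1) \<B>(1) by blast
    show "openin X V" if "V \<in> \<Union>(\<B> ` \<U>)" for V using that \<B>(2) by blast
    fix W x assume W: "openin X W \<and> x \<in> W"
    then obtain U where U: "U \<in> \<U>" "x \<in> U"
      using cov openin_subset by blast
    then have "openin X (W \<inter> U)" using W op by blast
    then obtain V where "V \<in> \<B> U" "x \<in> V" "V \<subseteq> W \<inter> U"
      using \<B>(3)[OF U(1), of "W \<inter> U" x] W U(2) by blast
    then show "\<exists>V\<in>\<Union>(\<B> ` \<U>). x \<in> V \<and> V \<subseteq> W" using U(1) by blast
  qed
qed

lemma (in Metric_space) Lindelof_imp_second_countable_mtopology: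
  assumes "Lindelof_space mtopology"
  shows "second_countable mtopology"
proof -
  let ?r = "\<lambda>n::nat. inverse (real (Suc n))"
  have "\<exists>C. countable C \<and> C \<subseteq> M \<and> M \<subseteq> (\<Union>x\<in>C. mball x (?r n))" for n
  proof -
    have "\<exists>\<V>. countable \<V> \<and> \<V> \<subseteq> (\<lambda>x. mball x (?r n)) ` M \<and> \<Union>\<V> = topspace mtopology"
      using assms by (rule Lindelof_spaceD) auto
    then show ?thesis
      unfolding topspace_mtopology using countable_subset_image by (metis order_refl)
  qed
  then obtain C where C: "\<And>n. countable (C n)" "\<And>n. C n \<subseteq> M" "\<And>n. M \<subseteq> (\<Union>x\<in>C n. mball x (?r n))"
    by metis
  define \<B> where "\<B> = (\<Union>n. (\<lambda>x. mball x (?r n)) ` C n)"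
  have "\<exists>V\<in>\<B>. x \<in> V \<and> V \<subseteq> U" if U: "openin mtopology U" "x \<in> U" for U x
  proof -
    obtain e where e: "e > 0" "mball x e \<subseteq> U" and x: "x \<in> M"
      using U unfolding openin_mtopology by blast
    obtain n where n: "?r n < e / 2"
      using e(1) reals_Archimedean[of "e / 2"] by auto
    obtain c where c: "c \<in> C n" "x \<in> mball c (?r n)"
      using C(3) x by blast
    have "mball c (?r n) \<subseteq> mball x e"
      using c(2) n by (intro mball_subset) (auto simp: commute)
    then show ?thesis using c e(2) unfolding \<B>_def by blast
  qed
  moreover have "countable \<B>" unfolding \<B>_def using C(1) by blast
  moreover have "\<forall>V\<in>\<B>. openin mtopology V" unfolding \<B>_def by auto
  ultimately show ?thesis unfolding second_countable_def by blast
qed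

lemma metrizable_Lindelof_imp_second_countable:
  assumes "metrizable_space X" "Lindelof_space X"
  shows "second_countable X"
  using assms Metric_space.Lindelof_imp_second_countable_mtopology
  unfolding metrizable_space_def by metis

lemma metrizable_space_subtopology_mono:
  "metrizable_space (subtopology X A) \<Longrightarrow> B \<subseteq> A \<Longrightarrow> metrizable_space (subtopology X B)"
  using metrizable_space_subtopology[of "subtopology X A" B]
  by (simp add: subtopology_subtopology Int_absorb1)

lemma compactin_metrizable_imp_second_countable:
  assumes "compactin X C" "C \<subseteq> N" "metrizable_space (subtopology X N)"
  shows "second_countable (subtopology X C)"
proof (rule metrizable_Lindelof_imp_second_countable)
  show "metrizable_space (subtopology X C)"
    using assms(3,2) by (rule metrizable_space_subtopology_mono)
  show "Lindelof_space (subtopology X C)"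
    using assms(1) by (simp add: compact_imp_Lindelof_space compact_space_subtopology)
qed

lemma regular_space_base_closure_subset:
  assumes "regular_space X"
    and \<B>: "\<And>B. B \<in> \<B> \<Longrightarrow> openin X B" "\<And>U x. openin X U \<Longrightarrow> x \<in> U \<Longrightarrow> \<exists>B\<in>\<B>. x \<in> B \<and> B \<subseteq> U"
    and U: "openin X U" "x \<in> U"
  obtains A B where "A \<in> \<B>" "B \<in> \<B>" "x \<in> A" "X closure_of A \<subseteq> B" "B \<subseteq> U"
proof -
  obtain B where B: "B \<in> \<B>" "x \<in> B" "B \<subseteq> U" using \<B>(2)[OF U] by blast
  then obtain V C where VC: "openin X V" "closedin X C" "x \<in> V" "V \<subseteq> C" "C \<subseteq> B"
    using assms(1) \<B>(1) unfolding neighbourhood_base_of_closedin[symmetric] neighbourhood_base_of by meson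
  then obtain A where A: "A \<in> \<B>" "x \<in> A" "A \<subseteq> V" using \<B>(2) by blast
  then have "X closure_of A \<subseteq> C" using VC by (intro closure_of_minimal) auto
  then show ?thesis using that A B VC(5) by blast
qed

lemma second_countable_normal_separating_functions:
  assumes "second_countable X" "normal_space X" "regular_space X"
  obtains F where "countable F" "\<And>f. f \<in> F \<Longrightarrow> continuous_map X euclideanreal f"
    "\<And>U x. openin X U \<Longrightarrow> x \<in> U \<Longrightarrow> \<exists>f\<in>F. f x = 0 \<and> (\<forall>y\<in>topspace X - U. f y = 1)"
proof -
  obtain \<B> where \<B>: "countable \<B>" "\<And>V. V \<in> \<B> \<Longrightarrow> openin X V"
    "\<And>U x. openin X U \<Longrightarrow> x \<in> U \<Longrightarrow> \<exists>V\<in>\<B>. x \<in> V \<and> V \<subseteq> U"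
    using assms(1) unfolding second_countable_def by metis
  define P where "P = {(W, V) \<in> \<B> \<times> \<B>. X closure_of W \<subseteq> V}"
  have "\<exists>f. continuous_map X euclideanreal f \<and> f ` (X closure_of W) \<subseteq> {0} \<and> f ` (topspace X - V) \<subseteq> {1}"
    if "(W, V) \<in> P" for W V
  proof -
    have "closedin X (topspace X - V)" "disjnt (X closure_of W) (topspace X - V)"
      using that \<B>(2) by (auto simp: P_def disjnt_iff)
    then obtain f where "continuous_map X (top_of_set {0..1}) f" "f ` (X closure_of W) \<subseteq> {0::real}"
      "f ` (topspace X - V) \<subseteq> {1}"
      using Urysohn_lemma[OF assms(2) closedin_closure_of, of _ W 0 1] by (metis zero_le_one)
    then show ?thesis by (auto simp: continuous_map_in_subtopology)
  qed
  then have "\<exists>f. continuous_map X euclideanreal f \<and> f ` (X closure_of fst p) \<subseteq> {0} \<and>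
      f ` (topspace X - snd p) \<subseteq> {1}" if "p \<in> P" for p
    using that by (metis prod.collapse)
  then obtain f where f: "\<And>p. p \<in> P \<Longrightarrow> continuous_map X euclideanreal (f p)"
    "\<And>p. p \<in> P \<Longrightarrow> f p ` (X closure_of fst p) \<subseteq> {0}" "\<And>p. p \<in> P \<Longrightarrow> f p ` (topspace X - snd p) \<subseteq> {1}"
    by metis
  show ?thesis
  proof
    show "countable (f ` P)"
      using countable_subset[of P "\<B> \<times> \<B>"] \<B>(1) by (auto simp: P_def)
    show "continuous_map X euclideanreal g" if "g \<in> f ` P" for g using that f(1) by blast
    fix U x assume "openin X U" "x \<in> U"
    then obtain W V where W: "W \<in> \<B>" "x \<in> W" and V: "V \<in> \<B>" "X closure_of W \<subseteq> V" "V \<subseteq> U"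
      using regular_space_base_closure_subset[OF assms(3) \<B>(2,3)] by metis
    then have WV: "(W, V) \<in> P" by (auto simp: P_def)
    have "x \<in> X closure_of W"
      using W(2) closure_of_subset[OF openin_subset[OF \<B>(2)[OF W(1)]]] by blast
    then have "f (W, V) x = 0" using f(2)[OF WV] by auto
    moreover have "f (W, V) y = 1" if "y \<in> topspace X - U" for y
      using f(3)[OF WV] that V(3) by auto
    ultimately show "\<exists>g\<in>f ` P. g x = 0 \<and> (\<forall>y\<in>topspace X - U. g y = 1)"
      using WV by blast
  qed
qed

lemma embedding_map_separating_functions:
  assumes "t1_space X" and F: "\<And>f. f \<in> F \<Longrightarrow> continuous_map X euclideanreal f"
    and sep: "\<And>U x. openin X U \<Longrightarrow> x \<in> U \<Longrightarrow> \<exists>f\<in>F. f x = 0 \<and> (\<forall>y\<in>topspace X - U. f y = 1)"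
  shows "embedding_map X (product_topology (\<lambda>_. euclideanreal) F) (\<lambda>x. \<lambda>f\<in>F. f x)"
    (is "embedding_map X ?Q ?e")
  unfolding embedding_map_def
proof (rule bijective_open_imp_homeomorphic_map)
  let ?Z = "subtopology ?Q (?e ` topspace X)"
  show "continuous_map X ?Z ?e"
    unfolding continuous_map_in_subtopology continuous_map_componentwise using F by auto
  show "?e ` topspace X = topspace ?Z" by auto
  show "inj_on ?e (topspace X)"
  proof (rule inj_onI, rule ccontr)
    fix x y assume xy: "x \<in> topspace X" "y \<in> topspace X" "?e x = ?e y" "x \<noteq> y"
    then obtain U where "openin X U" "x \<in> U" "y \<notin> U"
      using assms(1) t1_space_def by metis
    then obtain f where f: "f \<in> F" "f x = 0" "f y = 1"
      using sep xy(2) by (metis DiffI)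
    then show False using fun_cong[OF xy(3), of f] by simp
  qed
  show "open_map X ?Z ?e"
    unfolding open_map_def
  proof (intro allI impI)
    fix U assume U: "openin X U"
    show "openin ?Z (?e ` U)"
    proof (subst openin_subopen, intro ballI)
      fix w assume "w \<in> ?e ` U"
      then obtain x where x: "x \<in> U" "w = ?e x" by blast
      obtain f where f: "f \<in> F" "f x = 0" "\<forall>y\<in>topspace X - U. f y = 1"
        using sep[OF U x(1)] by blast
      let ?W = "{v \<in> topspace ?Q. v f \<in> {..<1}}"
      have "openin ?Q ?W"
        by (rule openin_continuous_map_preimage[OF continuous_map_product_projection[OF f(1)]]) simp
      then have "openin ?Z (?W \<inter> ?e ` topspace X)" by (rule openin_subtopology_Int)
      moreover have "w \<in> ?W \<inter> ?e ` topspace X"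
        using x f(1,2) openin_subset[OF U] by auto
      moreover have "?W \<inter> ?e ` topspace X \<subseteq> ?e ` U"
        using f(1,3) by (force simp: image_iff)
      ultimately show "\<exists>T. openin ?Z T \<and> w \<in> T \<and> T \<subseteq> ?e ` U" by blast
    qed
  qed
qed

theorem Urysohn_metrization:
  assumes "second_countable X" "regular_space X" "Hausdorff_space X"
  shows "metrizable_space X"
proof -
  have "normal_space X"
    using assms(1,2) by (simp add: regular_Lindelof_imp_normal_space second_countable_imp_Lindelof_space)
  then obtain F where F: "countable F" "\<And>f. f \<in> F \<Longrightarrow> continuous_map X euclideanreal f"
    "\<And>U x. openin X U \<Longrightarrow> x \<in> U \<Longrightarrow> \<exists>f\<in>F. f x = 0 \<and> (\<forall>y\<in>topspace X - U. f y = 1)"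
    using second_countable_normal_separating_functions[OF assms(1) _ assms(2)] by metis
  let ?Q = "product_topology (\<lambda>_. euclideanreal) F"
  have "embedding_map X ?Q (\<lambda>x. \<lambda>f\<in>F. f x)"
    using Hausdorff_imp_t1_space[OF assms(3)] F(2,3) by (rule embedding_map_separating_functions)
  then have "X homeomorphic_space subtopology ?Q ((\<lambda>x. \<lambda>f\<in>F. f x) ` topspace X)"
    by (rule embedding_map_imp_homeomorphic_space)
  moreover have "metrizable_space ?Q"
    unfolding metrizable_space_product_topology
    using F(1) metrizable_space_euclidean by (auto intro: countable_subset[of _ F])
  ultimately show ?thesis
    by (metis homeomorphic_metrizable_space metrizable_space_subtopology)
qed

section \<open>The compact-open topology\<close>

lemma topspace_compact_open_topology [simp]: "topspace (compact_open_topology X G) = G"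
proof -
  have "{h. h ` {} \<subseteq> {}} \<in> {{h. h ` C \<subseteq> U} | C U. compactin X C \<and> openin X U}"
    by blast
  then show ?thesis
    by (auto simp: compact_open_topology_def)
qed

lemma subtopology_compact_open_topology:
  "subtopology (compact_open_topology X G) H = compact_open_topology X (G \<inter> H)"
  by (simp add: compact_open_topology_def subtopology_subtopology)

lemma openin_compact_open_subbasic:
  assumes "compactin X C" "openin X U"
  shows "openin (compact_open_topology X G) {h \<in> G. h ` C \<subseteq> U}"
proof -
  have "openin (topology_generated_by {{h. h ` C \<subseteq> U} | C U. compactin X C \<and> openin X U}) {h. h ` C \<subseteq> U}"
    by (rule topology_generated_by_Basis) (use assms in blast)
  moreover have "{h \<in> G. h ` C \<subseteq> U} = {h. h ` C \<subseteq> U} \<inter> G" by blast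
  ultimately show ?thesis
    unfolding compact_open_topology_def by (simp only: openin_subtopology_Int)
qed

lemma continuous_map_into_compact_open_iff:
  "continuous_map T (compact_open_topology X G) f \<longleftrightarrow> f \<in> topspace T \<rightarrow> G \<and>
     (\<forall>C U. compactin X C \<and> openin X U \<longrightarrow> openin T {t \<in> topspace T. f t ` C \<subseteq> U})"
proof (intro iffI conjI allI impI)
  assume f: "continuous_map T (compact_open_topology X G) f"
  show G: "f \<in> topspace T \<rightarrow> G" using f by (auto simp: continuous_map_def)
  fix C U assume "compactin X C \<and> openin X U"
  then have "openin T {t \<in> topspace T. f t \<in> {h \<in> G. h ` C \<subseteq> U}}"
    by (intro openin_continuous_map_preimage[OF f] openin_compact_open_subbasic) auto
  moreover have "{t \<in> topspace T. f t \<in> {h \<in> G. h ` C \<subseteq> U}} = {t \<in> topspace T. f t ` C \<subseteq> U}"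
    using G by blast
  ultimately show "openin T {t \<in> topspace T. f t ` C \<subseteq> U}" by simp
next
  assume f: "f \<in> topspace T \<rightarrow> G \<and>
     (\<forall>C U. compactin X C \<and> openin X U \<longrightarrow> openin T {t \<in> topspace T. f t ` C \<subseteq> U})"
  have "continuous_map T (topology_generated_by {{h. h ` C \<subseteq> U} | C U. compactin X C \<and> openin X U}) f"
  proof (rule continuous_on_generated_topo)
    fix S assume "S \<in> {{h. h ` C \<subseteq> U} | C U. compactin X C \<and> openin X U}"
    then obtain C U where "compactin X C" "openin X U" "S = {h. h ` C \<subseteq> U}" by blast
    moreover have "f -` {h. h ` C \<subseteq> U} \<inter> topspace T = {t \<in> topspace T. f t ` C \<subseteq> U}" by blast
    ultimately show "openin T (f -` S \<inter> topspace T)" using f by simp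
  qed blast
  then show "continuous_map T (compact_open_topology X G) f"
    using f by (simp add: compact_open_topology_def continuous_map_in_subtopology image_subset_iff_funcset)
qed

lemma neighbourhood_base_at_compact_open:
  assumes subbasic: "\<And>C U. compactin X C \<Longrightarrow> openin X U \<Longrightarrow> h ` C \<subseteq> U \<Longrightarrow>
      \<exists>V W. openin (compact_open_topology X G) V \<and> P W \<and> h \<in> V \<and> V \<subseteq> W \<and> W \<subseteq> {g \<in> G. g ` C \<subseteq> U}"
    and Int: "\<And>V W. P V \<Longrightarrow> P W \<Longrightarrow> P (V \<inter> W)"
  shows "neighbourhood_base_at h P (compact_open_topology X G)"
  unfolding neighbourhood_base_at_def
proof (intro allI impI)
  fix S assume S: "openin (compact_open_topology X G) S \<and> h \<in> S"
  then obtain S' where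
    S': "openin (topology_generated_by {{h. h ` C \<subseteq> U} | C U. compactin X C \<and> openin X U}) S'" "S = S' \<inter> G"
    by (auto simp: compact_open_topology_def openin_subtopology)
  from openin_topology_generated_by[OF S'(1)]
  have "\<exists>V W. openin (compact_open_topology X G) V \<and> P W \<and> h \<in> V \<and> V \<subseteq> W \<and> W \<subseteq> S' \<inter> G" if "h \<in> S'"
    using that
  proof induction
    case (Int A B)
    then obtain V W V' W' where
      "openin (compact_open_topology X G) V" "P W" "h \<in> V" "V \<subseteq> W" "W \<subseteq> A \<inter> G"
      "openin (compact_open_topology X G) V'" "P W'" "h \<in> V'" "V' \<subseteq> W'" "W' \<subseteq> B \<inter> G"
      by auto
    then show ?case
      by (intro exI[of _ "V \<inter> V'"] exI[of _ "W \<inter> W'"]) (auto intro: assms(2))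
  next
    case (UN \<K>)
    then obtain A where "A \<in> \<K>" "h \<in> A" by blast
    from UN.IH[OF this] show ?case using \<open>A \<in> \<K>\<close> by (meson Int_mono Union_upper order_refl order_trans)
  next
    case (Basis A)
    then obtain C U where "compactin X C" "openin X U" "A = {h. h ` C \<subseteq> U}" by blast
    moreover have "{g \<in> G. g ` C \<subseteq> U} = {h. h ` C \<subseteq> U} \<inter> G" by blast
    ultimately show ?case using subbasic[of C U] Basis.prems by simp
  qed simp
  then show "\<exists>V W. openin (compact_open_topology X G) V \<and> P W \<and> h \<in> V \<and> V \<subseteq> W \<and> W \<subseteq> S"
    using S S'(2) by simp
qed

lemma continuous_map_compact_open_eval:
  assumes "\<And>g. g \<in> G \<Longrightarrow> continuous_map X X g" "p \<in> topspace X"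
  shows "continuous_map (compact_open_topology X G) X (\<lambda>h. h p)"
  unfolding continuous_map_def
proof (intro conjI allI impI)
  show "(\<lambda>h. h p) \<in> topspace (compact_open_topology X G) \<rightarrow> topspace X"
    using assms by (auto simp: continuous_map_def)
  show "openin (compact_open_topology X G) {h \<in> topspace (compact_open_topology X G). h p \<in> U}"
    if "openin X U" for U
    using openin_compact_open_subbasic[of X "{p}" U G] assms(2) that by simp
qed

lemma closedin_compact_open_image_subset:
  assumes "\<And>g. g \<in> G \<Longrightarrow> continuous_map X X g" "C \<subseteq> topspace X" "closedin X D"
  shows "closedin (compact_open_topology X G) {g \<in> G. g ` C \<subseteq> D}"
proof -
  have "closedin (compact_open_topology X G) {g \<in> G. g c \<in> D}" if "c \<in> C" for c
    using closedin_continuous_map_preimage[OF continuous_map_compact_open_eval[OF assms(1)] assms(3)]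
      assms(2) that by auto
  then have "closedin (compact_open_topology X G) (\<Inter>(insert G ((\<lambda>c. {g \<in> G. g c \<in> D}) ` C)))"
    using closedin_topspace[of "compact_open_topology X G"] by (intro closedin_Inter) auto
  moreover have "\<Inter>(insert G ((\<lambda>c. {g \<in> G. g c \<in> D}) ` C)) = {g \<in> G. g ` C \<subseteq> D}"
    by auto
  ultimately show ?thesis by (simp only:)
qed

lemma regular_space_compact_open:
  assumes "regular_space X" and G: "\<And>g. g \<in> G \<Longrightarrow> continuous_map X X g"
  shows "regular_space (compact_open_topology X G)"
  unfolding neighbourhood_base_of_closedin[symmetric] neighbourhood_base_of_def
    topspace_compact_open_topology
proof
  fix h assume h: "h \<in> G"
  show "neighbourhood_base_at h (closedin (compact_open_topology X G)) (compact_open_topology X G)"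
  proof (rule neighbourhood_base_at_compact_open)
    fix C U assume CU: "compactin X C" "openin X U" "h ` C \<subseteq> U"
    have "compactin X (h ` C) \<and> closedin X (topspace X - U) \<and> disjnt (h ` C) (topspace X - U)"
      using image_compactin[OF CU(1) G[OF h]] CU(2,3) by (auto simp: disjnt_iff)
    then obtain V V' where V: "openin X V" "openin X V'" "h ` C \<subseteq> V" "topspace X - U \<subseteq> V'" "disjnt V V'"
      using regular_space_compact_closed_sets assms(1) by metis
    have "V \<subseteq> topspace X - V'" "topspace X - V' \<subseteq> U"
      using V openin_subset[OF V(1)] by (auto simp: disjnt_iff)
    moreover have "closedin (compact_open_topology X G) {g \<in> G. g ` C \<subseteq> topspace X - V'}"
      using closedin_compact_open_image_subset[OF G compactin_subset_topspace[OF CU(1)]] V(2) by blast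
    ultimately show "\<exists>A B. openin (compact_open_topology X G) A \<and> closedin (compact_open_topology X G) B \<and>
        h \<in> A \<and> A \<subseteq> B \<and> B \<subseteq> {g \<in> G. g ` C \<subseteq> U}"
      using openin_compact_open_subbasic[OF CU(1) V(1), of G] h V(3)
      by (intro exI[of _ "{g \<in> G. g ` C \<subseteq> V}"] exI[of _ "{g \<in> G. g ` C \<subseteq> topspace X - V'}"]) auto
  qed auto
qed

lemma openin_compact_open_finite:
  assumes "finite I" "\<And>i. i \<in> I \<Longrightarrow> compactin X (C i)" "\<And>i. i \<in> I \<Longrightarrow> openin X (U i)"
  shows "openin (compact_open_topology X G) {g \<in> G. \<forall>i\<in>I. g ` C i \<subseteq> U i}"
  using assms
proof (induction I)
  case empty
  then show ?case using openin_topspace[of "compact_open_topology X G"] by simp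
next
  case (insert i I)
  then have "openin (compact_open_topology X G) ({g \<in> G. g ` C i \<subseteq> U i} \<inter> {g \<in> G. \<forall>i\<in>I. g ` C i \<subseteq> U i})"
    by (intro openin_Int openin_compact_open_subbasic) auto
  moreover have "{g \<in> G. g ` C i \<subseteq> U i} \<inter> {g \<in> G. \<forall>i\<in>I. g ` C i \<subseteq> U i} =
      {g \<in> G. \<forall>i\<in>insert i I. g ` C i \<subseteq> U i}"
    by blast
  ultimately show ?case by (simp only:)
qed

lemma locally_compact_base_pair:
  assumes X: "locally_compact_space X" "Hausdorff_space X"
    and \<A>: "\<And>A. A \<in> \<A> \<Longrightarrow> openin X A" "\<And>U x. openin X U \<Longrightarrow> x \<in> U \<Longrightarrow> \<exists>A\<in>\<A>. x \<in> A \<and> A \<subseteq> U"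
    and \<B>: "\<And>B. B \<in> \<B> \<Longrightarrow> openin Y B" "\<And>U y. openin Y U \<Longrightarrow> y \<in> U \<Longrightarrow> \<exists>B\<in>\<B>. y \<in> B \<and> B \<subseteq> U"
    and h: "continuous_map X Y h" and x: "x \<in> topspace X" and U: "openin Y U" "h x \<in> U"
  shows "\<exists>A\<in>\<A>. \<exists>B\<in>\<B>. x \<in> A \<and> compactin X (X closure_of A) \<and> h ` (X closure_of A) \<subseteq> B \<and> B \<subseteq> U"
proof -
  obtain B where B: "B \<in> \<B>" "h x \<in> B" "B \<subseteq> U"
    using \<B>(2)[OF U] by metis
  have "openin X {y \<in> topspace X. h y \<in> B}"
    using h \<B>(1)[OF B(1)] by (rule openin_continuous_map_preimage)
  moreover have "x \<in> {y \<in> topspace X. h y \<in> B}"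
    using B(2) x by blast
  moreover have "neighbourhood_base_of (\<lambda>D. compactin X D \<and> closedin X D) X"
    using X locally_compact_space_neighbourhood_base_closedin by blast
  ultimately obtain V D where VD: "openin X V" "compactin X D" "closedin X D" "x \<in> V" "V \<subseteq> D"
    "D \<subseteq> {y \<in> topspace X. h y \<in> B}"
    unfolding neighbourhood_base_of by meson
  obtain A where A: "A \<in> \<A>" "x \<in> A" "A \<subseteq> V" using \<A>(2) VD(1,4) by blast
  have "X closure_of A \<subseteq> D"
    using A(3) VD(3,5) by (intro closure_of_minimal) auto
  then have "compactin X (X closure_of A)" "h ` (X closure_of A) \<subseteq> B"
    using VD(2,6) closed_compactin[of X D "X closure_of A"] by auto
  then show ?thesis using A(1,2) B(1,3) by blast
qed

lemma compact_open_refine_by_bases: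
  assumes X: "locally_compact_space X" "Hausdorff_space X"
    and \<A>: "\<And>A. A \<in> \<A> \<Longrightarrow> openin X A" "\<And>U x. openin X U \<Longrightarrow> x \<in> U \<Longrightarrow> \<exists>A\<in>\<A>. x \<in> A \<and> A \<subseteq> U"
    and \<B>: "\<And>B. B \<in> \<B> \<Longrightarrow> openin Y B" "\<And>U y. openin Y U \<Longrightarrow> y \<in> U \<Longrightarrow> \<exists>B\<in>\<B>. y \<in> B \<and> B \<subseteq> U"
    and h: "continuous_map X Y h" and C: "compactin X C" and U: "openin Y U" "h ` C \<subseteq> U"
  obtains F where "finite F" "F \<subseteq> \<A> \<times> \<B>"
    "\<And>p. p \<in> F \<Longrightarrow> compactin X (X closure_of fst p) \<and> h ` (X closure_of fst p) \<subseteq> snd p"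
    "\<And>g. (\<And>p. p \<in> F \<Longrightarrow> g ` (X closure_of fst p) \<subseteq> snd p) \<Longrightarrow> g ` C \<subseteq> U"
proof -
  have "\<exists>A\<in>\<A>. \<exists>B\<in>\<B>. x \<in> A \<and> compactin X (X closure_of A) \<and> h ` (X closure_of A) \<subseteq> B \<and> B \<subseteq> U"
    if "x \<in> C" for x
    using that U compactin_subset_topspace[OF C] by (intro locally_compact_base_pair[OF X \<A> \<B> h]) auto
  then obtain a b where ab: "\<And>x. x \<in> C \<Longrightarrow> a x \<in> \<A> \<and> b x \<in> \<B> \<and> x \<in> a x \<and>
      compactin X (X closure_of a x) \<and> h ` (X closure_of a x) \<subseteq> b x \<and> b x \<subseteq> U"
    by metis
  then obtain E where E: "finite E" "E \<subseteq> C" "C \<subseteq> (\<Union>x\<in>E. a x)"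
    using compactin_finite_pointwise_cover[OF C, of a] \<A>(1) by metis
  show ?thesis
  proof (rule that[of "(\<lambda>x. (a x, b x)) ` E"])
    show "finite ((\<lambda>x. (a x, b x)) ` E)" using E(1) by simp
    show "(\<lambda>x. (a x, b x)) ` E \<subseteq> \<A> \<times> \<B>" using E(2) ab by blast
    show "compactin X (X closure_of fst p) \<and> h ` (X closure_of fst p) \<subseteq> snd p"
      if p: "p \<in> (\<lambda>x. (a x, b x)) ` E" for p
    proof -
      obtain x where "x \<in> C" "p = (a x, b x)" using p E(2) by blast
      then show ?thesis using ab[of x] by simp
    qed
    show "g ` C \<subseteq> U" if g: "\<And>p. p \<in> (\<lambda>x. (a x, b x)) ` E \<Longrightarrow> g ` (X closure_of fst p) \<subseteq> snd p" for g
    proof (rule image_subsetI)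
      fix c assume "c \<in> C"
      then obtain x where x: "x \<in> E" "c \<in> a x" using E(3) by blast
      then have "openin X (a x)" "b x \<subseteq> U" using E(2) ab \<A>(1) by blast+
      then have "c \<in> X closure_of a x"
        using x(2) closure_of_subset[OF openin_subset] by blast
      then show "g c \<in> U" using g[of "(a x, b x)"] x(1) \<open>b x \<subseteq> U\<close> by auto
    qed
  qed
qed

lemma second_countable_compact_open:
  assumes X: "locally_compact_space X" "Hausdorff_space X" "second_countable X"
    and G: "\<And>g. g \<in> G \<Longrightarrow> continuous_map X X g"
  shows "second_countable (compact_open_topology X G)"
proof -
  obtain \<B> where \<B>: "countable \<B>" "\<And>B. B \<in> \<B> \<Longrightarrow> openin X B"
    "\<And>U x. openin X U \<Longrightarrow> x \<in> U \<Longrightarrow> \<exists>B\<in>\<B>. x \<in> B \<and> B \<subseteq> U"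
    using X(3) unfolding second_countable_def by metis
  define S where "S F = {g \<in> G. \<forall>p\<in>F. g ` (X closure_of fst p) \<subseteq> snd p}" for F
  define \<S> where "\<S> = S ` {F. finite F \<and> F \<subseteq> \<B> \<times> \<B>}"
  have "neighbourhood_base_at h (\<lambda>V. V \<in> \<S>) (compact_open_topology X G)" if h: "h \<in> G" for h
  proof (rule neighbourhood_base_at_compact_open)
    fix C U assume CU: "compactin X C" "openin X U" "h ` C \<subseteq> U"
    obtain F where F: "finite F" "F \<subseteq> \<B> \<times> \<B>"
      "\<And>p. p \<in> F \<Longrightarrow> compactin X (X closure_of fst p) \<and> h ` (X closure_of fst p) \<subseteq> snd p"
      "\<And>g. (\<And>p. p \<in> F \<Longrightarrow> g ` (X closure_of fst p) \<subseteq> snd p) \<Longrightarrow> g ` C \<subseteq> U"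
      using compact_open_refine_by_bases[OF X(1,2) \<B>(2,3) \<B>(2,3) G[OF h] CU] by metis
    have "openin (compact_open_topology X G) (S F)"
      unfolding S_def using F(1-3) \<B>(2) by (intro openin_compact_open_finite) auto
    moreover have "h \<in> S F" unfolding S_def using h F(3) by blast
    moreover have "S F \<subseteq> {g \<in> G. g ` C \<subseteq> U}" unfolding S_def using F(4) by blast
    ultimately show "\<exists>V W. openin (compact_open_topology X G) V \<and> W \<in> \<S> \<and> h \<in> V \<and> V \<subseteq> W \<and>
        W \<subseteq> {g \<in> G. g ` C \<subseteq> U}"
      using F(1,2) unfolding \<S>_def by blast
  next
    fix V W assume "V \<in> \<S>" "W \<in> \<S>"
    then obtain E F where "finite E" "E \<subseteq> \<B> \<times> \<B>" "V = S E" "finite F" "F \<subseteq> \<B> \<times> \<B>" "W = S F"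
      unfolding \<S>_def by blast
    moreover have "S E \<inter> S F = S (E \<union> F)" by (auto simp: S_def)
    ultimately show "V \<inter> W \<in> \<S>" unfolding \<S>_def by blast
  qed
  moreover have "countable \<S>"
    unfolding \<S>_def using \<B>(1) by (intro countable_image countable_Collect_finite_subset) auto
  ultimately show ?thesis
    unfolding second_countable_neighbourhood_base neighbourhood_base_of_def topspace_compact_open_topology
    by blast
qed

section \<open>Homeomorphisms supported in a set\<close>

lemma topspace_Homeo_top [simp]: "topspace (Homeo_top X K) = Homeo X K"
  by (simp add: Homeo_top_def)

lemma Homeo_mono: "K \<subseteq> L \<Longrightarrow> Homeo X K \<subseteq> Homeo X L"
  by (auto simp: Homeo_def)

lemma Homeo_top_mono: "K \<subseteq> L \<Longrightarrow> Homeo_top X K = subtopology (Homeo_top X L) (Homeo X K)"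
  using Homeo_mono[of K L X]
  by (simp add: Homeo_top_def subtopology_compact_open_topology Int_absorb1)

lemma id_in_Homeo [simp]: "id \<in> Homeo X K"
  by (simp add: Homeo_def)

lemma Homeo_continuous_map: "h \<in> Homeo X K \<Longrightarrow> continuous_map X X h"
  by (simp add: Homeo_def homeomorphic_imp_continuous_map)

lemma Homeo_fixes: "h \<in> Homeo X K \<Longrightarrow> x \<notin> K \<Longrightarrow> h x = x"
  by (simp add: Homeo_def)

lemma Homeo_comp: "g \<in> Homeo X K \<Longrightarrow> h \<in> Homeo X K \<Longrightarrow> g \<circ> h \<in> Homeo X K"
  using homeomorphic_map_compose[of X X h X g] by (simp add: Homeo_def)

lemma Homeo_bij:
  assumes "h \<in> Homeo X K" "K \<subseteq> topspace X"
  shows "bij h"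
proof -
  have "bij_betw h (topspace X) (topspace X)"
    using assms(1) by (auto simp: Homeo_def bij_betw_def homeomorphic_eq_everything_map)
  moreover have "bij_betw h (- topspace X) (- topspace X)"
    using bij_betw_cong[of "- topspace X" h id] Homeo_fixes[OF assms(1)] assms(2) by auto
  ultimately have "bij_betw h (topspace X \<union> - topspace X) (topspace X \<union> - topspace X)"
    by (rule bij_betw_combine) auto
  then show ?thesis by simp
qed

lemma Homeo_image:
  assumes "h \<in> Homeo X K" "K \<subseteq> topspace X"
  shows "h ` K = K"
proof -
  have "h ` (- K) = - K"
    using Homeo_fixes[OF assms(1)] by (force simp: image_iff)
  then have "- (h ` K) = - K"
    using Homeo_bij[OF assms] by (simp add: bij_image_Compl_eq)
  then show ?thesis by simp
qed

lemma Homeo_inv: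
  assumes "h \<in> Homeo X K" "K \<subseteq> topspace X"
  shows "inv h \<in> Homeo X K"
proof -
  have h: "bij h" using Homeo_bij[OF assms] .
  obtain g where g: "homeomorphic_maps X X h g"
    using assms(1) by (auto simp: Homeo_def homeomorphic_map_maps)
  have "inv h y = g y" if "y \<in> topspace X" for y
    using g that h by (metis bij_inv_eq_iff homeomorphic_maps_def)
  then have "homeomorphic_map X X (inv h)"
    using homeomorphic_map_eq[OF homeomorphic_maps_imp_map[OF iffD1[OF homeomorphic_maps_sym g]]]
    by metis
  moreover have "inv h x = x" if "x \<notin> K" for x
    using h Homeo_fixes[OF assms(1) that] by (metis bij_inv_eq_iff)
  ultimately show ?thesis by (simp add: Homeo_def)
qed

lemma continuous_map_Homeo_left_translation:
  assumes g: "g \<in> Homeo X K"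
  shows "continuous_map (Homeo_top X K) (Homeo_top X K) ((\<circ>) g)"
  unfolding Homeo_top_def continuous_map_into_compact_open_iff topspace_compact_open_topology
proof (intro conjI allI impI)
  show "(\<circ>) g \<in> Homeo X K \<rightarrow> Homeo X K" using g by (auto intro: Homeo_comp)
  fix C U assume CU: "compactin X C \<and> openin X U"
  let ?V = "{x \<in> topspace X. g x \<in> U}"
  have "openin X ?V"
    using CU openin_continuous_map_preimage[OF Homeo_continuous_map[OF g]] by blast
  then have "openin (compact_open_topology X (Homeo X K)) {h \<in> Homeo X K. h ` C \<subseteq> ?V}"
    using CU by (intro openin_compact_open_subbasic) auto
  moreover have "(g \<circ> h) ` C \<subseteq> U \<longleftrightarrow> h ` C \<subseteq> ?V" if "h \<in> Homeo X K" for h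
    using compactin_subset_topspace[of X "h ` C"] image_compactin[OF _ Homeo_continuous_map[OF that]] CU
    by auto
  ultimately show "openin (compact_open_topology X (Homeo X K)) {h \<in> Homeo X K. (g \<circ> h) ` C \<subseteq> U}"
    by (metis (mono_tags, lifting) Collect_cong)
qed

lemma homeomorphic_map_Homeo_left_translation:
  assumes "g \<in> Homeo X K" "K \<subseteq> topspace X"
  shows "homeomorphic_map (Homeo_top X K) (Homeo_top X K) ((\<circ>) g)"
proof -
  have "inv g \<circ> (g \<circ> h) = h" "g \<circ> (inv g \<circ> h) = h" for h :: "'a \<Rightarrow> 'a"
    using Homeo_bij[OF assms] by (auto simp: fun_eq_iff bij_is_inj bij_is_surj surj_f_inv_f)
  then have "homeomorphic_maps (Homeo_top X K) (Homeo_top X K) ((\<circ>) g) ((\<circ>) (inv g))"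
    unfolding homeomorphic_maps_def
    by (intro conjI continuous_map_Homeo_left_translation Homeo_inv assms) auto
  then show ?thesis by (rule homeomorphic_maps_imp_map)
qed

lemma Homeo_top_discrete_if_id_isolated:
  assumes "openin (Homeo_top X K) {id}" "K \<subseteq> topspace X"
  shows "Homeo_top X K = discrete_topology (Homeo X K)"
proof -
  have "openin (Homeo_top X K) {g}" if "g \<in> Homeo X K" for g
  proof -
    have "openin (Homeo_top X K) ((\<circ>) g ` {id})"
      using homeomorphic_map_Homeo_left_translation[OF that assms(2)] assms(1)
      by (meson homeomorphic_imp_open_map open_map_def)
    then show ?thesis by simp
  qed
  then show ?thesis
    by (metis discrete_topology_unique topspace_Homeo_top)
qed

lemma Homeo_top_discrete_mono:
  assumes "L \<subseteq> K" "Homeo_top X K = discrete_topology (Homeo X K)"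
  shows "Homeo_top X L = discrete_topology (Homeo X L)"
  unfolding Homeo_top_mono[OF assms(1)] assms(2) using Homeo_mono[OF assms(1)] by (simp add: Int_absorb1)

lemma locally_compact_Homeo_top_if_at_id:
  assumes U: "openin (Homeo_top X K) U" "id \<in> U" "U \<subseteq> N" "compactin (Homeo_top X K) N"
    and K: "K \<subseteq> topspace X"
  shows "locally_compact_space (Homeo_top X K)"
  unfolding locally_compact_space_def
proof
  fix g assume "g \<in> topspace (Homeo_top X K)"
  then have g: "homeomorphic_map (Homeo_top X K) (Homeo_top X K) ((\<circ>) g)"
    using homeomorphic_map_Homeo_left_translation K by auto
  have "openin (Homeo_top X K) ((\<circ>) g ` U)"
    using g U(1) by (meson homeomorphic_imp_open_map open_map_def)
  moreover have "compactin (Homeo_top X K) ((\<circ>) g ` N)"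
    using g U(4) by (meson homeomorphic_imp_continuous_map image_compactin)
  moreover have "g \<in> (\<circ>) g ` U" using U(2) by (metis comp_id image_eqI)
  ultimately show "\<exists>V L. openin (Homeo_top X K) V \<and> compactin (Homeo_top X K) L \<and> g \<in> V \<and> V \<subseteq> L"
    using U(3) by blast
qed

lemma Homeo_image_Int_subset_iff:
  assumes "h \<in> Homeo X K" "K \<subseteq> topspace X" "C - K \<subseteq> U"
  shows "h ` (C \<inter> K) \<subseteq> U \<inter> K \<longleftrightarrow> h ` C \<subseteq> U"
proof -
  have "h ` C = h ` (C \<inter> K) \<union> (C - K)"
    using Homeo_fixes[OF assms(1)] by force
  then show ?thesis using Homeo_image[OF assms(1,2)] assms(3) by blast
qed

lemma Homeo_top_eq_compact_open_subtopology:
  assumes K: "closedin X K"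
  shows "Homeo_top X K = compact_open_topology (subtopology X K) (Homeo X K)"
proof -
  let ?T = "compact_open_topology X (Homeo X K)"
    and ?S = "compact_open_topology (subtopology X K) (Homeo X K)"
  have K': "K \<subseteq> topspace X" using K by (rule closedin_subset)
  have "continuous_map ?S ?T id"
    unfolding continuous_map_into_compact_open_iff topspace_compact_open_topology
  proof (intro conjI allI impI)
    fix C U assume CU: "compactin X C \<and> openin X U"
    show "openin ?S {h \<in> Homeo X K. id h ` C \<subseteq> U}"
    proof (cases "C - K \<subseteq> U")
      case True
      have "openin ?S {h \<in> Homeo X K. h ` (C \<inter> K) \<subseteq> U \<inter> K}"
        using CU K by (intro openin_compact_open_subbasic)
          (auto simp: compactin_subtopology openin_subtopology compact_Int_closedin)
      then show ?thesis
        using Homeo_image_Int_subset_iff[OF _ K' True] by (simp cong: conj_cong)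
    next
      case False
      then have "{h \<in> Homeo X K. id h ` C \<subseteq> U} = {}" using Homeo_fixes by fastforce
      then show ?thesis by (simp only: openin_empty)
    qed
  qed simp
  moreover have "continuous_map ?T ?S id"
    unfolding continuous_map_into_compact_open_iff topspace_compact_open_topology
  proof (intro conjI allI impI)
    fix C U assume CU: "compactin (subtopology X K) C \<and> openin (subtopology X K) U"
    then obtain V where V: "openin X V" "U = V \<inter> K" by (auto simp: openin_subtopology)
    have "openin ?T {h \<in> Homeo X K. h ` C \<subseteq> V}"
      using CU V(1) by (intro openin_compact_open_subbasic) (auto simp: compactin_subtopology)
    moreover have "h ` C \<subseteq> V \<longleftrightarrow> h ` C \<subseteq> U" if "h \<in> Homeo X K" for h
      using V(2) CU Homeo_image[OF that K'] by (auto simp: compactin_subtopology)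
    ultimately show "openin ?T {h \<in> Homeo X K. id h ` C \<subseteq> U}"
      by (metis (mono_tags, lifting) Collect_cong id_apply)
  qed simp
  ultimately have "homeomorphic_maps ?T ?S id id"
    by (simp add: homeomorphic_maps_def)
  then show ?thesis by (simp add: Homeo_top_def homeomorphic_maps_id)
qed

lemma second_countable_Homeo_top:
  assumes "Hausdorff_space X" "compactin X K" "metrizable_space (subtopology X K)"
  shows "second_countable (Homeo_top X K)"
proof -
  have K: "K \<subseteq> topspace X" "closedin X K" "compact_space (subtopology X K)"
    using assms(1,2)
    by (auto simp: compactin_subset_topspace compactin_imp_closedin compact_space_subtopology)
  have "continuous_map (subtopology X K) (subtopology X K) g" if "g \<in> Homeo X K" for g
    using that Homeo_image[OF that K(1)]
    by (auto simp: continuous_map_in_subtopology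
        intro: continuous_map_from_subtopology Homeo_continuous_map)
  moreover have "second_countable (subtopology X K)"
    using compactin_metrizable_imp_second_countable[OF assms(2) subset_refl assms(3)] .
  ultimately show ?thesis
    unfolding Homeo_top_eq_compact_open_subtopology[OF K(2)] using K(3) assms(1)
    by (intro second_countable_compact_open compact_imp_locally_compact_space Hausdorff_space_subtopology)
qed

lemma regular_space_Homeo_top: "regular_space X \<Longrightarrow> regular_space (Homeo_top X K)"
  unfolding Homeo_top_def by (rule regular_space_compact_open) (auto intro: Homeo_continuous_map)

lemma continuous_map_Homeo_top_eval: "p \<in> topspace X \<Longrightarrow> continuous_map (Homeo_top X K) X (\<lambda>h. h p)"
  unfolding Homeo_top_def by (rule continuous_map_compact_open_eval) (auto intro: Homeo_continuous_map)

lemma Homeo_small_support_image_subset: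
  assumes X: "Hausdorff_space X" "x \<in> topspace X" and K: "K \<subseteq> topspace X"
    and CU: "compactin X C" "openin X U" "C \<subseteq> U"
  shows "\<exists>N. openin X N \<and> x \<in> N \<and> Homeo X (N \<inter> K) \<subseteq> {g \<in> Homeo X K. g ` C \<subseteq> U}"
proof (cases "x \<in> U")
  case True
  have "g ` C \<subseteq> U" if g: "g \<in> Homeo X (U \<inter> K)" for g
  proof -
    have "g ` (U \<inter> K) = U \<inter> K" using Homeo_image[OF g] K by blast
    then have "g c \<in> U" if "c \<in> U" for c
      using that Homeo_fixes[OF g] by (metis IntD1 imageI)
    then show ?thesis using CU(3) by blast
  qed
  then show ?thesis using True CU(2) Homeo_mono[of "U \<inter> K" K X] by (intro exI[of _ U]) auto
next
  case False
  have "g ` C \<subseteq> U" if "g \<in> Homeo X ((topspace X - C) \<inter> K)" for g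
    using CU(3) Homeo_fixes[OF that] by auto
  moreover have "openin X (topspace X - C)" "x \<in> topspace X - C"
    using False CU X by (auto simp: compactin_imp_closedin)
  ultimately show ?thesis
    using Homeo_mono[of "(topspace X - C) \<inter> K" K X] by (intro exI[of _ "topspace X - C"]) auto
qed

lemma Homeo_top_nhds_contains_small_support:
  assumes X: "Hausdorff_space X" "x \<in> topspace X" and K: "K \<subseteq> topspace X"
    and W: "openin (Homeo_top X K) W" "id \<in> W"
  obtains N where "openin X N" "x \<in> N" "Homeo X (N \<inter> K) \<subseteq> W"
proof -
  have "neighbourhood_base_at id (\<lambda>V. \<exists>N. openin X N \<and> x \<in> N \<and> Homeo X (N \<inter> K) \<subseteq> V) (Homeo_top X K)"
    unfolding Homeo_top_def
  proof (rule neighbourhood_base_at_compact_open)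
    fix C U assume CU: "compactin X C" "openin X U" "id ` C \<subseteq> U"
    have "\<exists>N. openin X N \<and> x \<in> N \<and> Homeo X (N \<inter> K) \<subseteq> {g \<in> Homeo X K. g ` C \<subseteq> U}"
      using CU by (intro Homeo_small_support_image_subset[OF X K]) auto
    moreover have "openin (compact_open_topology X (Homeo X K)) {g \<in> Homeo X K. g ` C \<subseteq> U}"
      using CU(1,2) by (rule openin_compact_open_subbasic)
    ultimately show "\<exists>V W. openin (compact_open_topology X (Homeo X K)) V \<and>
        (\<exists>N. openin X N \<and> x \<in> N \<and> Homeo X (N \<inter> K) \<subseteq> W) \<and> id \<in> V \<and> V \<subseteq> W \<and> W \<subseteq> {g \<in> Homeo X K. g ` C \<subseteq> U}"
      using CU(3) by (intro exI[of _ "{g \<in> Homeo X K. g ` C \<subseteq> U}"]) auto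
  next
    fix V W
    assume "\<exists>N. openin X N \<and> x \<in> N \<and> Homeo X (N \<inter> K) \<subseteq> V"
      and "\<exists>N. openin X N \<and> x \<in> N \<and> Homeo X (N \<inter> K) \<subseteq> W"
    then obtain M N where "openin X M" "x \<in> M" "Homeo X (M \<inter> K) \<subseteq> V"
      and "openin X N" "x \<in> N" "Homeo X (N \<inter> K) \<subseteq> W"
      by blast
    moreover have "Homeo X (M \<inter> N \<inter> K) \<subseteq> Homeo X (M \<inter> K) \<inter> Homeo X (N \<inter> K)"
      by (auto simp: Homeo_def)
    ultimately show "\<exists>N. openin X N \<and> x \<in> N \<and> Homeo X (N \<inter> K) \<subseteq> V \<inter> W"
      by (intro exI[of _ "M \<inter> N"]) auto
  qed
  then show ?thesis
    using W that unfolding neighbourhood_base_at_def by (meson order_trans)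
qed

lemma not_locally_compact_Homeo_top_if_collapsing:
  assumes X: "Hausdorff_space X" "x \<in> topspace X" and K: "K \<subseteq> topspace X"
    and collapse: "\<And>N. openin X N \<Longrightarrow> x \<in> N \<Longrightarrow> \<exists>(h :: nat \<Rightarrow> 'a \<Rightarrow> 'a) y. y \<in> topspace X - {x} \<and>
      (\<forall>k. h k \<in> Homeo X (N \<inter> K) \<and> h k x = x) \<and> limitin X (\<lambda>k. h k y) x sequentially"
  shows "\<not> locally_compact_space (Homeo_top X K)"
proof
  assume "locally_compact_space (Homeo_top X K)"
  then obtain W Q where W: "openin (Homeo_top X K) W" "compactin (Homeo_top X K) Q" "id \<in> W" "W \<subseteq> Q"
    unfolding locally_compact_space_def by (metis id_in_Homeo topspace_Homeo_top)
  obtain N where "openin X N" "x \<in> N" and NW: "Homeo X (N \<inter> K) \<subseteq> W"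
    using Homeo_top_nhds_contains_small_support[OF X K W(1,3)] .
  then obtain h :: "nat \<Rightarrow> 'a \<Rightarrow> 'a" and y where y: "y \<in> topspace X" "y \<noteq> x"
    and h: "\<And>k. h k \<in> Homeo X (N \<inter> K)" "\<And>k. h k x = x" "limitin X (\<lambda>k. h k y) x sequentially"
    using collapse by (metis DiffE singletonI)
  have "h k \<in> Q" for k using h(1) NW W(4) by blast
  then obtain z where z: "z \<in> Q" "cluster_pointin (Homeo_top X K) h z"
    using compactin_imp_cluster_pointin[OF W(2)] by blast
  have eval: "z p = l" if "p \<in> topspace X" "limitin X (\<lambda>k. h k p) l sequentially" for p l
    using cluster_pointin_limitin_unique[OF X(1) _ that(2)]
      continuous_map_cluster_pointin[OF continuous_map_Homeo_top_eval[OF that(1)] z(2)] by (simp add: o_def)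
  have "z y = x" using eval y(1) h(3) by blast
  moreover have "z x = x" using eval X(2) h(2) by simp
  moreover have "inj z"
    using z(1) compactin_subset_topspace[OF W(2)] Homeo_bij[OF _ K] bij_is_inj by auto
  ultimately show False using y(2) by (metis injD)
qed

section \<open>Topological groups of maps\<close>

lemma topological_group_of_maps_comp:
  assumes "topological_group_of_maps T" "g \<in> topspace T" "h \<in> topspace T"
  shows "g \<circ> h \<in> topspace T"
proof -
  have "continuous_map (prod_topology T T) T (\<lambda>p. fst p \<circ> snd p)"
    using assms(1) by (simp add: topological_group_of_maps_def)
  then have "(\<lambda>p. fst p \<circ> snd p) \<in> topspace T \<times> topspace T \<rightarrow> topspace T"
    by (simp add: continuous_map_def)
  then show ?thesis using assms(2,3) by (auto simp: Pi_iff)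
qed

lemma continuous_map_right_division:
  assumes "topological_group_of_maps T"
  shows "continuous_map (prod_topology T T) T (\<lambda>p. fst p \<circ> inv (snd p))"
proof -
  have comp: "continuous_map (prod_topology T T) T (\<lambda>p. fst p \<circ> snd p)"
    and inv: "continuous_map T T inv"
    using assms by (simp_all add: topological_group_of_maps_def)
  have "continuous_map (prod_topology T T) (prod_topology T T) (\<lambda>p. (fst p, inv (snd p)))"
    using continuous_map_compose[OF continuous_map_snd inv]
    by (auto simp: continuous_map_pairwise o_def continuous_map_fst)
  from continuous_map_compose[OF this comp] show ?thesis
    by (simp add: o_def)
qed

lemma topological_group_of_maps_nhds_comp:
  assumes "topological_group_of_maps T" "id \<in> topspace T" "openin T W" "id \<in> W"
  obtains U V where "openin T U" "id \<in> U" "openin T V" "id \<in> V" "\<forall>g\<in>U. \<forall>h\<in>V. g \<circ> h \<in> W"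
proof -
  let ?P = "{p \<in> topspace (prod_topology T T). fst p \<circ> snd p \<in> W}"
  have "openin (prod_topology T T) ?P"
    using assms(1,3) by (intro openin_continuous_map_preimage) (simp_all add: topological_group_of_maps_def)
  moreover have "(id, id) \<in> ?P" using assms(2,4) by simp
  ultimately obtain U V where "openin T U" "openin T V" "id \<in> U" "id \<in> V" "U \<times> V \<subseteq> ?P"
    unfolding openin_prod_topology_alt by meson
  moreover from this have "\<forall>g\<in>U. \<forall>h\<in>V. g \<circ> h \<in> W" by auto
  ultimately show ?thesis using that by blast
qed

lemma no_cluster_pointin_comp:
  assumes grp: "topological_group_of_maps T" and surj: "\<And>n. surj (y n)"
    and y: "limitin T y id sequentially" and x: "\<And>z. \<not> cluster_pointin T x z"
  shows "\<not> cluster_pointin T (\<lambda>n. x n \<circ> y n) z"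
proof
  assume "cluster_pointin T (\<lambda>n. x n \<circ> y n) z"
  then have "cluster_pointin (prod_topology T T) (\<lambda>n. (x n \<circ> y n, y n)) (z, id)"
    using y by (rule cluster_pointin_pairwise)
  from continuous_map_cluster_pointin[OF continuous_map_right_division[OF grp] this]
  have "cluster_pointin T (\<lambda>n. x n \<circ> y n \<circ> inv (y n)) (z \<circ> inv id)"
    by (simp add: comp_def)
  moreover have "x n \<circ> y n \<circ> inv (y n) = x n" for n
    using surj by (simp add: fun_eq_iff surj_f_inv_f)
  ultimately show False using x by simp
qed

lemma closedin_range_comp:
  assumes "topological_group_of_maps T" "t1_space T" "\<And>n. x n \<in> topspace T" "\<And>n. y n \<in> topspace T"
    and "\<And>n. surj (y n)" "limitin T y id sequentially" "\<And>z. \<not> cluster_pointin T x z"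
  shows "closedin T (range (\<lambda>n. x n \<circ> y n))"
  using assms
  by (intro closedin_range_no_cluster_pointin topological_group_of_maps_comp no_cluster_pointin_comp)

section \<open>The colimit topology\<close>

lemma openin_colimit_topology:
  "openin (colimit_topology I T) U \<longleftrightarrow>
     U \<subseteq> (\<Union>i\<in>I. topspace (T i)) \<and> (\<forall>i\<in>I. openin (T i) (U \<inter> topspace (T i)))"
proof -
  have "istopology (\<lambda>U. U \<subseteq> (\<Union>i\<in>I. topspace (T i)) \<and> (\<forall>i\<in>I. openin (T i) (U \<inter> topspace (T i))))"
    unfolding istopology_def
  proof (intro conjI allI impI ballI)
    fix A B i assume "A \<subseteq> (\<Union>i\<in>I. topspace (T i)) \<and> (\<forall>i\<in>I. openin (T i) (A \<inter> topspace (T i)))"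
      "B \<subseteq> (\<Union>i\<in>I. topspace (T i)) \<and> (\<forall>i\<in>I. openin (T i) (B \<inter> topspace (T i)))" "i \<in> I"
    then have "openin (T i) ((A \<inter> topspace (T i)) \<inter> (B \<inter> topspace (T i)))" by blast
    then show "openin (T i) (A \<inter> B \<inter> topspace (T i))" by (simp add: Int_ac)
  next
    fix \<K> i assume \<K>: "\<forall>A\<in>\<K>. A \<subseteq> (\<Union>i\<in>I. topspace (T i)) \<and> (\<forall>i\<in>I. openin (T i) (A \<inter> topspace (T i)))"
      and "i \<in> I"
    then have "openin (T i) (\<Union>((\<lambda>A. A \<inter> topspace (T i)) ` \<K>))" by blast
    then show "openin (T i) (\<Union>\<K> \<inter> topspace (T i))" by (simp add: Int_commute Int_Union)
  qed blast+
  then show ?thesis by (simp add: colimit_topology_def)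
qed

lemma topspace_colimit_topology:
  "topspace (colimit_topology I T) = (\<Union>i\<in>I. topspace (T i))"
proof (rule subset_antisym)
  show "topspace (colimit_topology I T) \<subseteq> (\<Union>i\<in>I. topspace (T i))"
    using openin_colimit_topology[of I T "topspace (colimit_topology I T)"] by simp
  have "(\<Union>i\<in>I. topspace (T i)) \<inter> topspace (T i) = topspace (T i)" if "i \<in> I" for i
    using that by blast
  then have "openin (colimit_topology I T) (\<Union>i\<in>I. topspace (T i))"
    unfolding openin_colimit_topology by simp
  then show "(\<Union>i\<in>I. topspace (T i)) \<subseteq> topspace (colimit_topology I T)"
    by (rule openin_subset)
qed

lemma closedin_colimit_topology:
  "closedin (colimit_topology I T) S \<longleftrightarrow>
     S \<subseteq> (\<Union>i\<in>I. topspace (T i)) \<and> (\<forall>i\<in>I. closedin (T i) (S \<inter> topspace (T i)))"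
proof -
  have "((\<Union>i\<in>I. topspace (T i)) - S) \<inter> topspace (T i) = topspace (T i) - S \<inter> topspace (T i)"
    if "i \<in> I" for i
    using that by blast
  then show ?thesis
    by (simp add: closedin_def openin_colimit_topology topspace_colimit_topology)
qed

lemma continuous_map_from_colimit_topology:
  assumes "\<And>i. i \<in> I \<Longrightarrow> continuous_map (T i) Y f"
  shows "continuous_map (colimit_topology I T) Y f"
  unfolding continuous_map_def
proof (intro conjI allI impI)
  show "f \<in> topspace (colimit_topology I T) \<rightarrow> topspace Y"
    using assms by (fastforce simp: continuous_map_def topspace_colimit_topology)
  fix U assume U: "openin Y U"
  have "{x \<in> topspace (colimit_topology I T). f x \<in> U} \<inter> topspace (T i) = {x \<in> topspace (T i). f x \<in> U}"
    if "i \<in> I" for i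
    using that by (auto simp: topspace_colimit_topology)
  moreover have "openin (T i) {x \<in> topspace (T i). f x \<in> U}" if "i \<in> I" for i
    using assms[OF that] U by (rule openin_continuous_map_preimage)
  ultimately show "openin (colimit_topology I T) {x \<in> topspace (colimit_topology I T). f x \<in> U}"
    unfolding openin_colimit_topology by (auto simp: topspace_colimit_topology)
qed

lemma continuous_map_into_colimit_topology:
  "i \<in> I \<Longrightarrow> continuous_map (T i) (colimit_topology I T) id"
  by (auto simp: continuous_map_def openin_colimit_topology topspace_colimit_topology Int_def conj_commute)

lemma closedin_colimit_topology_UN:
  assumes "\<And>n. closedin (colimit_topology I T) (S n)"
    and "\<And>i. i \<in> I \<Longrightarrow> finite {n. S n \<inter> topspace (T i) \<noteq> {}}"
  shows "closedin (colimit_topology I T) (\<Union>n. S n)"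
  unfolding closedin_colimit_topology
proof (intro conjI ballI)
  show "(\<Union>n. S n) \<subseteq> (\<Union>i\<in>I. topspace (T i))"
    using assms(1) by (auto simp: closedin_colimit_topology)
  fix i assume i: "i \<in> I"
  have "closedin (T i) (\<Union>n\<in>{n. S n \<inter> topspace (T i) \<noteq> {}}. S n \<inter> topspace (T i))"
    using assms i by (intro closedin_Union) (auto simp: closedin_colimit_topology)
  moreover have "(\<Union>n\<in>{n. S n \<inter> topspace (T i) \<noteq> {}}. S n \<inter> topspace (T i)) = (\<Union>n. S n) \<inter> topspace (T i)"
    by blast
  ultimately show "closedin (T i) ((\<Union>n. S n) \<inter> topspace (T i))" by simp
qed

section \<open>The colimit of the homeomorphism groups\<close>

abbreviation Homeo_colimit :: "'a topology \<Rightarrow> ('a \<Rightarrow> 'a) topology" where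
  "Homeo_colimit X \<equiv> colimit_topology {K. compactin X K} (Homeo_top X)"

lemma Homeo_subset_colimit: "compactin X K \<Longrightarrow> Homeo X K \<subseteq> topspace (Homeo_colimit X)"
  by (auto simp: topspace_colimit_topology)

lemma id_in_Homeo_colimit: "id \<in> topspace (Homeo_colimit X)"
  using Homeo_subset_colimit[of X "{}"] by auto

lemma Homeo_colimit_imp_Homeo:
  "h \<in> topspace (Homeo_colimit X) \<Longrightarrow> h \<in> Homeo X (topspace X)"
  by (auto simp: topspace_colimit_topology intro: Homeo_mono[OF compactin_subset_topspace, THEN subsetD])

lemma continuous_map_Homeo_colimit_eval:
  "p \<in> topspace X \<Longrightarrow> continuous_map (Homeo_colimit X) X (\<lambda>h. h p)"
  by (intro continuous_map_from_colimit_topology continuous_map_Homeo_top_eval)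

lemma Homeo_top_eq_subtopology_colimit:
  assumes K: "compactin X K"
  shows "Homeo_top X K = subtopology (Homeo_colimit X) (Homeo X K)"
proof -
  have "continuous_map (Homeo_top X L) (Homeo_top X (topspace X)) id" if "compactin X L" for L
    unfolding Homeo_top_mono[OF compactin_subset_topspace[OF that]]
    by (rule continuous_map_from_subtopology) simp
  then have "continuous_map (Homeo_colimit X) (Homeo_top X (topspace X)) id"
    by (intro continuous_map_from_colimit_topology) simp
  then have "continuous_map (subtopology (Homeo_colimit X) (Homeo X K)) (Homeo_top X K) id"
    unfolding Homeo_top_mono[OF compactin_subset_topspace[OF K]]
    by (auto simp: continuous_map_in_subtopology continuous_map_from_subtopology)
  moreover have "continuous_map (Homeo_top X K) (subtopology (Homeo_colimit X) (Homeo X K)) id"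
    using continuous_map_into_colimit_topology[of K "{K. compactin X K}" "Homeo_top X"] K
    by (simp add: continuous_map_in_subtopology)
  ultimately have "homeomorphic_maps (subtopology (Homeo_colimit X) (Homeo X K)) (Homeo_top X K) id id"
    by (simp add: homeomorphic_maps_def)
  then show ?thesis by (simp add: homeomorphic_maps_id)
qed

lemma closedin_Homeo_colimit_Homeo:
  assumes "Hausdorff_space X" "compactin X K"
  shows "closedin (Homeo_colimit X) (Homeo X K)"
proof -
  let ?G = "topspace (Homeo_colimit X)"
  have "closedin (Homeo_colimit X) {h \<in> ?G. h p = p}" if "p \<in> topspace X" for p
    using that by (intro closedin_continuous_maps_eq[OF assms(1)] continuous_map_Homeo_colimit_eval) auto
  then have "closedin (Homeo_colimit X) (\<Inter>(insert ?G ((\<lambda>p. {h \<in> ?G. h p = p}) ` (topspace X - K))))"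
    by (intro closedin_Inter) auto
  moreover have "\<Inter>(insert ?G ((\<lambda>p. {h \<in> ?G. h p = p}) ` (topspace X - K))) = Homeo X K"
    using Homeo_subset_colimit[OF assms(2)] Homeo_colimit_imp_Homeo by (force simp: Homeo_def)
  ultimately show ?thesis by (simp only:)
qed

lemma Hausdorff_space_Homeo_colimit:
  assumes "Hausdorff_space X"
  shows "Hausdorff_space (Homeo_colimit X)"
  unfolding Hausdorff_space_def
proof (intro allI impI)
  let ?G = "topspace (Homeo_colimit X)"
  fix g h assume gh: "g \<in> ?G \<and> h \<in> ?G \<and> g \<noteq> h"
  then obtain p where p: "g p \<noteq> h p" by auto
  then have "p \<in> topspace X" using gh Homeo_colimit_imp_Homeo Homeo_fixes by metis
  then have eval: "continuous_map (Homeo_colimit X) X (\<lambda>f. f p)"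
    by (rule continuous_map_Homeo_colimit_eval)
  then have "g p \<in> topspace X" "h p \<in> topspace X"
    using gh by (auto simp: continuous_map_def)
  then obtain U V where UV: "openin X U" "openin X V" "g p \<in> U" "h p \<in> V" "disjnt U V"
    using assms p unfolding Hausdorff_space_def by metis
  have "openin (Homeo_colimit X) {f \<in> ?G. f p \<in> U}" "openin (Homeo_colimit X) {f \<in> ?G. f p \<in> V}"
    using openin_continuous_map_preimage[OF eval] UV(1,2) by blast+
  moreover have "disjnt {f \<in> ?G. f p \<in> U} {f \<in> ?G. f p \<in> V}"
    using UV(5) by (auto simp: disjnt_iff)
  ultimately show "\<exists>U V. openin (Homeo_colimit X) U \<and> openin (Homeo_colimit X) V \<and>
      g \<in> U \<and> h \<in> V \<and> disjnt U V"
    using gh UV(3,4) by blast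
qed

lemma Homeo_sequence_no_cluster_pointin:
  assumes X: "locally_compact_space X" "Hausdorff_space X"
    and K: "compactin X K" "metrizable_space (subtopology X K)" "\<not> locally_compact_space (Homeo_top X K)"
    and W: "openin (Homeo_top X K) W" "id \<in> W"
  obtains x :: "nat \<Rightarrow> 'a \<Rightarrow> 'a" where "range x \<subseteq> W" "\<And>z. \<not> cluster_pointin (Homeo_colimit X) x z"
proof -
  have "regular_space (Homeo_top X K)"
    using X locally_compact_Hausdorff_imp_regular_space by (intro regular_space_Homeo_top) blast
  then obtain U N where U: "openin (Homeo_top X K) U" "closedin (Homeo_top X K) N" "id \<in> U" "U \<subseteq> N" "N \<subseteq> W"
    using W unfolding neighbourhood_base_of_closedin[symmetric] neighbourhood_base_of by meson
  have "\<not> compactin (Homeo_top X K) N"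
    using locally_compact_Homeo_top_if_at_id[OF U(1,3,4)] K(1,3) compactin_subset_topspace by blast
  then obtain x :: "nat \<Rightarrow> 'a \<Rightarrow> 'a" where x: "range x \<subseteq> N" "\<And>z. \<not> cluster_pointin (Homeo_top X K) x z"
    using Lindelof_noncompact_closed_imp_sequence[OF second_countable_imp_Lindelof_space U(2)]
      second_countable_Homeo_top[OF X(2) K(1,2)] by metis
  have xK: "x n \<in> Homeo X K" for n
    using x(1) closedin_subset[OF U(2)] by auto
  have "\<not> cluster_pointin (Homeo_colimit X) x z" for z
  proof
    assume z: "cluster_pointin (Homeo_colimit X) x z"
    then have "z \<in> Homeo X K"
      using cluster_pointin_closedin[OF closedin_Homeo_colimit_Homeo[OF X(2) K(1)]] xK by blast
    then have "cluster_pointin (Homeo_top X K) x z"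
      unfolding Homeo_top_eq_subtopology_colimit[OF K(1)]
      using z xK by (simp add: cluster_pointin_subtopology)
    then show False using x(2) by blast
  qed
  then show ?thesis using that x(1) U(5) by blast
qed

lemma Homeo_sequence_limitin_id:
  assumes X: "Hausdorff_space X"
    and K: "compactin X K" "metrizable_space (subtopology X K)"
      "Homeo_top X K \<noteq> discrete_topology (Homeo X K)"
  obtains y :: "nat \<Rightarrow> 'a \<Rightarrow> 'a" where "range y \<subseteq> Homeo X K - {id}"
    "limitin (Homeo_colimit X) y id sequentially"
proof -
  have "\<not> openin (Homeo_top X K) {id}"
    using Homeo_top_discrete_if_id_isolated K(1,3) compactin_subset_topspace by blast
  moreover have "U = {id}" if "id \<in> U" "\<nexists>f. f \<noteq> id \<and> f \<in> Homeo X K \<and> f \<in> U" "openin (Homeo_top X K) U" for U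
    using that openin_subset[OF that(3)] by auto
  ultimately have "id \<in> Homeo_top X K derived_set_of Homeo X K"
    unfolding in_derived_set_of by (metis id_in_Homeo topspace_Homeo_top)
  then obtain y where "range y \<subseteq> Homeo X K - {id}" "limitin (Homeo_top X K) y id sequentially"
    using derived_set_of_imp_limitin_sequence second_countable_imp_first_countable
      second_countable_Homeo_top[OF X K(1,2)] by metis
  then show ?thesis
    using that Homeo_top_eq_subtopology_colimit[OF K(1)] by (simp add: limitin_subtopology)
qed

lemma Homeo_comp_moves_point:
  assumes "g \<in> Homeo X M" "h \<in> Homeo X K" "h \<noteq> id" "K \<subseteq> topspace X" "K \<inter> M = {}"
  obtains p where "p \<in> K" "(g \<circ> h) p \<noteq> p"
proof -
  obtain p where p: "h p \<noteq> p" using assms(3) by (auto simp: fun_eq_iff)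
  then have "p \<in> K" using Homeo_fixes[OF assms(2)] by blast
  moreover from this have "h p \<in> K" using Homeo_image[OF assms(2,4)] by blast
  then have "g (h p) = h p" using assms(5) Homeo_fixes[OF assms(1)] by blast
  ultimately show ?thesis using that p by simp
qed

lemma Homeo_no_cluster_pointin_sequences:
  assumes X: "locally_compact_space X" "Hausdorff_space X"
    and K: "compactin X K" "metrizable_space (subtopology X K)" "\<not> locally_compact_space (Homeo_top X K)"
  obtains x :: "nat \<Rightarrow> nat \<Rightarrow> 'a \<Rightarrow> 'a" where "\<And>n m. x n m \<in> Homeo X K"
    "\<And>n z. \<not> cluster_pointin (Homeo_colimit X) (x n) z"
    "\<And>W. openin (Homeo_colimit X) W \<Longrightarrow> id \<in> W \<Longrightarrow> \<exists>n. range (x n) \<subseteq> W"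
proof -
  have "first_countable (Homeo_top X K)"
    using second_countable_Homeo_top[OF X(2) K(1,2)] by (rule second_countable_imp_first_countable)
  then obtain B where B: "\<And>n. openin (Homeo_top X K) (B n)" "\<And>n. id \<in> B n"
    "\<And>W. openin (Homeo_top X K) W \<Longrightarrow> id \<in> W \<Longrightarrow> \<exists>n::nat. B n \<subseteq> W"
    using first_countable_decseq_base[of "Homeo_top X K" id] by (metis id_in_Homeo topspace_Homeo_top)
  have "\<exists>x. range x \<subseteq> B n \<and> (\<forall>z. \<not> cluster_pointin (Homeo_colimit X) x z)" for n
    using Homeo_sequence_no_cluster_pointin[OF X K B(1,2), of n] by metis
  then obtain x where x: "\<And>n. range (x n) \<subseteq> B n" "\<And>n z. \<not> cluster_pointin (Homeo_colimit X) (x n) z"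
    by metis
  show ?thesis
  proof
    show "x n m \<in> Homeo X K" for n m
      using x(1) openin_subset[OF B(1)] by fastforce
    show "\<exists>n. range (x n) \<subseteq> W" if W: "openin (Homeo_colimit X) W" "id \<in> W" for W
    proof -
      have "openin (Homeo_top X K) (W \<inter> Homeo X K)"
        using W(1) by (simp add: Homeo_top_eq_subtopology_colimit[OF K(1)] openin_subtopology_Int)
      then obtain n where "B n \<subseteq> W" using B(3) W(2) by (metis Int_subset_iff IntI id_in_Homeo)
      then show ?thesis using x(1) by blast
    qed
  qed (rule x(2))
qed

lemma closedin_Homeo_colimit_UN_moving:
  assumes F: "\<And>n. closedin (Homeo_colimit X) (F n)" "\<And>n g. g \<in> F n \<Longrightarrow> \<exists>p\<in>K n. g p \<noteq> p"
    and K: "\<And>C. compactin X C \<Longrightarrow> finite {n. K n \<inter> C \<noteq> {}}"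
  shows "closedin (Homeo_colimit X) (\<Union>n. F n)"
proof (rule closedin_colimit_topology_UN[OF F(1)])
  fix C assume "C \<in> {C. compactin X C}"
  then have "finite {n. K n \<inter> C \<noteq> {}}" using K by blast
  moreover have "{n. F n \<inter> topspace (Homeo_top X C) \<noteq> {}} \<subseteq> {n. K n \<inter> C \<noteq> {}}"
    using F(2) Homeo_fixes[of _ X C] by (simp; blast)
  ultimately show "finite {n. F n \<inter> topspace (Homeo_top X C) \<noteq> {}}"
    by (rule finite_subset[rotated])
qed

lemma closedin_Homeo_colimit_range_comp:
  assumes X: "Hausdorff_space X" and grp: "topological_group_of_maps (Homeo_colimit X)"
    and x: "compactin X M" "\<And>m. x m \<in> Homeo X M" "\<And>z. \<not> cluster_pointin (Homeo_colimit X) x z"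
    and y: "compactin X K" "\<And>m. y m \<in> Homeo X K" "limitin (Homeo_colimit X) y id sequentially"
  shows "closedin (Homeo_colimit X) (range (\<lambda>m. x m \<circ> y m))"
proof (rule closedin_range_comp[OF grp _ _ _ _ y(3) x(3)])
  show "t1_space (Homeo_colimit X)"
    using X by (intro Hausdorff_imp_t1_space Hausdorff_space_Homeo_colimit)
  show "x m \<in> topspace (Homeo_colimit X)" "y m \<in> topspace (Homeo_colimit X)" for m
    using x(2) y(2) Homeo_subset_colimit x(1) y(1) by blast+
  show "surj (y m)" for m
    using Homeo_bij[OF y(2) compactin_subset_topspace[OF y(1)]] by (rule bij_is_surj)
qed

theorem not_Homeo_family_ACP:
  fixes K :: "nat \<Rightarrow> 'a set"
  assumes X: "locally_compact_space X" "Hausdorff_space X"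
    and M: "compactin X M" "metrizable_space (subtopology X M)" "\<not> locally_compact_space (Homeo_top X M)"
    and K: "\<And>n. compactin X (K n)" "\<And>n. metrizable_space (subtopology X (K n))"
      "\<And>n. Homeo_top X (K n) \<noteq> discrete_topology (Homeo X (K n))"
    and disj: "\<And>n. K n \<inter> M = {}"
    and fin: "\<And>C. compactin X C \<Longrightarrow> finite {n. K n \<inter> C \<noteq> {}}"
  shows "\<not> Homeo_family_ACP X"
proof
  let ?T = "Homeo_colimit X"
  assume "Homeo_family_ACP X"
  then have grp: "topological_group_of_maps ?T" by (simp add: Homeo_family_ACP_def)
  obtain x where x: "\<And>n m. x n m \<in> Homeo X M" "\<And>n z. \<not> cluster_pointin ?T (x n) z"
    "\<And>W. openin ?T W \<Longrightarrow> id \<in> W \<Longrightarrow> \<exists>n::nat. range (x n) \<subseteq> W"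
    using Homeo_no_cluster_pointin_sequences[OF X M] by metis
  have "\<exists>y. range y \<subseteq> Homeo X (K n) - {id} \<and> limitin ?T y id sequentially" for n
    using Homeo_sequence_limitin_id[OF X(2) K] by metis
  then obtain y where y: "\<And>n m. y n m \<in> Homeo X (K n) - {id}" "\<And>n. limitin ?T (y n) id sequentially"
    by (metis range_subsetD)
  define F where "F n = range (\<lambda>m. x n m \<circ> y n m)" for n
  have "closedin ?T (F n)" for n
    unfolding F_def using y(1)
    by (intro closedin_Homeo_colimit_range_comp[OF X(2) grp M(1) x(1,2) K(1) _ y(2)]) blast
  moreover have moves: "\<exists>p\<in>K n. g p \<noteq> p" if g: "g \<in> F n" for g n
  proof -
    obtain m where "g = x n m \<circ> y n m" using g by (auto simp: F_def)
    then show ?thesis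
      using Homeo_comp_moves_point[OF x(1), of "y n m" "K n"] y(1)[of n m] K(1) disj
        compactin_subset_topspace
      by (metis DiffE singletonI)
  qed
  ultimately have "closedin ?T (\<Union>n. F n)"
    using fin by (rule closedin_Homeo_colimit_UN_moving)
  then have "openin ?T (topspace ?T - (\<Union>n. F n))" by blast
  moreover have "id \<in> topspace ?T - (\<Union>n. F n)"
    using moves[of id] id_in_Homeo_colimit by auto
  ultimately obtain U V where U: "openin ?T U" "id \<in> U" and V: "openin ?T V" "id \<in> V"
    and UV: "\<forall>g\<in>U. \<forall>h\<in>V. g \<circ> h \<in> topspace ?T - (\<Union>n. F n)"
    by (rule topological_group_of_maps_nhds_comp[OF grp id_in_Homeo_colimit])
  obtain n where "range (x n) \<subseteq> U" using x(3)[OF U] ..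
  moreover obtain m where "y n m \<in> V"
    using eventually_happens[OF limitinD[OF y(2) V]] by auto
  ultimately have "x n m \<circ> y n m \<notin> (\<Union>n. F n)" using UV by blast
  then show False by (auto simp: F_def)
qed

section \<open>Discrete families of compact neighbourhoods\<close>

lemma infinite_discrete_closed_in_iff:
  "infinite_discrete_closed_in X T \<longleftrightarrow> T \<subseteq> topspace X \<and> infinite T \<and> X derived_set_of T = {}"
  unfolding infinite_discrete_closed_in_def closedin_contains_derived_set
    subtopology_eq_discrete_topology_eq
  by blast

lemma infinite_discrete_closed_in_subset:
  assumes "infinite_discrete_closed_in X T" "S \<subseteq> T" "infinite S"
  shows "infinite_discrete_closed_in X S"
  using assms derived_set_of_mono[OF assms(2), of X] by (auto simp: infinite_discrete_closed_in_iff)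

lemma infinite_discrete_closed_in_subtopology:
  assumes "infinite_discrete_closed_in X T" "T \<subseteq> A"
  shows "infinite_discrete_closed_in (subtopology X A) T"
  using assms by (auto simp: infinite_discrete_closed_in_iff derived_set_of_subtopology Int_absorb1)

lemma finite_Int_compactin_infinite_discrete_closed_in:
  assumes "infinite_discrete_closed_in X T" "compactin X M"
  shows "finite (T \<inter> M)"
proof -
  have T: "closedin X T" "subtopology X T = discrete_topology T"
    using assms(1) by (auto simp: infinite_discrete_closed_in_def)
  have "compactin X (T \<inter> M)" using T(1) assms(2) by (rule closed_Int_compactin)
  then have "compactin (subtopology X T) (T \<inter> M)" by (simp add: compactin_subtopology)
  then show ?thesis by (simp add: T(2) compactin_discrete_topology)
qed

lemma infinite_discrete_closed_in_diff_compactin: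
  assumes "infinite_discrete_closed_in X T" "compactin X M"
  shows "infinite_discrete_closed_in X (T - M)"
proof (rule infinite_discrete_closed_in_subset[OF assms(1) Diff_subset])
  show "infinite (T - M)"
    using finite_Int_compactin_infinite_discrete_closed_in[OF assms] assms(1)
    by (metis Un_Diff_Int finite_Un infinite_discrete_closed_in_def)
qed

lemma Tietze_extension_infinite_discrete_closed:
  assumes "normal_space X" "infinite_discrete_closed_in X T"
  obtains t :: "nat \<Rightarrow> 'a" and f where "inj t" "range t \<subseteq> T" "continuous_map X euclideanreal f"
    "\<And>n. f (t n) = real n"
proof -
  have "infinite T" using assms(2) by (simp add: infinite_discrete_closed_in_def)
  then obtain t :: "nat \<Rightarrow> 'a" where t: "inj t" "range t \<subseteq> T"
    using infinite_countable_subset by blast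
  have "infinite_discrete_closed_in X (range t)"
    using infinite_discrete_closed_in_subset[OF assms(2) t(2)] t(1) by (simp add: finite_image_iff)
  then have S: "closedin X (range t)" "subtopology X (range t) = discrete_topology (range t)"
    by (auto simp: infinite_discrete_closed_in_def)
  have "continuous_map (subtopology X (range t)) euclideanreal (\<lambda>x. real (inv t x))"
    unfolding S(2) by simp
  then obtain f where f: "continuous_map X euclideanreal f" "\<And>x. x \<in> range t \<Longrightarrow> f x = real (inv t x)"
    using Tietze_extension_realinterval[OF assms(1) S(1) is_interval_univ, of "\<lambda>x. real (inv t x)"] by auto
  have "f (t n) = real n" for n using f(2)[of "t n"] t(1) by simp
  then show ?thesis using that t f(1) by blast
qed

lemma locally_finite_in_separated_by_function:
  assumes A: "closedin X A" and f: "continuous_map (subtopology X A) euclideanreal f"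
    and K: "\<And>n::nat. K n \<subseteq> A" "\<And>n x. x \<in> K n \<Longrightarrow> \<bar>f x - real n\<bar> < 1/3"
  shows "disjoint_family K" "locally_finite_in X (range K)"
proof -
  have "m = n" if "x \<in> K m" "x \<in> K n" for x m n
    using K(2)[OF that(1)] K(2)[OF that(2)] by linarith
  then show "disjoint_family K" by (auto simp: disjoint_family_on_def)
  have AX: "A \<subseteq> topspace X" using A by (rule closedin_subset)
  have "\<exists>V. openin X V \<and> x \<in> V \<and> finite {S \<in> range K. S \<inter> V \<noteq> {}}" if x: "x \<in> topspace X" for x
  proof (cases "x \<in> A")
    case True
    have "openin (subtopology X A) {y \<in> topspace (subtopology X A). f y \<in> ball (f x) (1/3)}"
      using f by (rule openin_continuous_map_preimage) simp
    then obtain V where V: "openin X V" "{y \<in> topspace (subtopology X A). f y \<in> ball (f x) (1/3)} = V \<inter> A"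
      by (auto simp: openin_subtopology)
    have near: "\<bar>f y - f x\<bar> < 1/3" if "y \<in> V \<inter> A" for y
    proof -
      have "f y \<in> ball (f x) (1/3)" using that V(2) by blast
      then show ?thesis by (simp add: dist_real_def abs_minus_commute)
    qed
    have "x \<in> V" using True AX V(2) by force
    moreover have "{S \<in> range K. S \<inter> V \<noteq> {}} \<subseteq> K ` {..nat \<lceil>f x + 1\<rceil>}"
    proof
      fix S assume "S \<in> {S \<in> range K. S \<inter> V \<noteq> {}}"
      then obtain n y where S: "S = K n" and "y \<in> K n" "y \<in> V" by blast
      then have "y \<in> V \<inter> A" using K(1) by blast
      then have "real n \<le> f x + 1" using near[of y] K(2)[OF \<open>y \<in> K n\<close>] by linarith
      then have "n \<le> nat \<lceil>f x + 1\<rceil>" by linarith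
      then show "S \<in> K ` {..nat \<lceil>f x + 1\<rceil>}" using S by simp
    qed
    then have "finite {S \<in> range K. S \<inter> V \<noteq> {}}" by (rule finite_subset) simp
    ultimately show ?thesis using V(1) by blast
  next
    case False
    have "{S \<in> range K. S \<inter> (topspace X - A) \<noteq> {}} = {}" using K(1) by blast
    then have "finite {S \<in> range K. S \<inter> (topspace X - A) \<noteq> {}}" by (simp only: finite.emptyI)
    then show ?thesis using x False A by (intro exI[of _ "topspace X - A"]) blast
  qed
  then show "locally_finite_in X (range K)"
    using K(1) AX unfolding locally_finite_in_def by blast
qed

lemma locally_finite_in_compactin:
  assumes "locally_finite_in X \<A>" "compactin X C"
  shows "finite {S \<in> \<A>. S \<inter> C \<noteq> {}}"
proof -
  have "\<forall>x\<in>C. \<exists>V. openin X V \<and> x \<in> V \<and> finite {S \<in> \<A>. S \<inter> V \<noteq> {}}"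
    using assms compactin_subset_topspace unfolding locally_finite_in_def by blast
  from bchoice[OF this] obtain V where
    V: "\<forall>x\<in>C. openin X (V x) \<and> x \<in> V x \<and> finite {S \<in> \<A>. S \<inter> V x \<noteq> {}}" ..
  then obtain F where F: "finite F" "F \<subseteq> C" "C \<subseteq> (\<Union>x\<in>F. V x)"
    using compactin_finite_pointwise_cover[OF assms(2), of V] by metis
  have "{S \<in> \<A>. S \<inter> C \<noteq> {}} \<subseteq> (\<Union>x\<in>F. {S \<in> \<A>. S \<inter> V x \<noteq> {}})"
  proof
    fix S assume "S \<in> {S \<in> \<A>. S \<inter> C \<noteq> {}}"
    then obtain y where y: "S \<in> \<A>" "y \<in> S" "y \<in> C" by blast
    moreover obtain x where "x \<in> F" "y \<in> V x" using F(3) y(3) by blast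
    ultimately show "S \<in> (\<Union>x\<in>F. {S \<in> \<A>. S \<inter> V x \<noteq> {}})" by blast
  qed
  moreover have "finite (\<Union>x\<in>F. {S \<in> \<A>. S \<inter> V x \<noteq> {}})" using F(1,2) V by auto
  ultimately show ?thesis by (rule finite_subset)
qed

lemma finite_disjoint_locally_finite_compactin:
  assumes "disjoint_family K" "locally_finite_in X (range K)" "\<And>n. K n \<noteq> {}" "compactin X C"
  shows "finite {n. K n \<inter> C \<noteq> {}}"
proof -
  have "K m \<noteq> K n" if "m \<noteq> n" for m n
    using disjoint_family_onD[OF assms(1) _ _ that] assms(3) by auto
  then have "inj K" by (auto simp: inj_on_def)
  from finite_vimageI[OF locally_finite_in_compactin[OF assms(2,4)] this] show ?thesis
    by (simp add: vimage_def)
qed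

lemma locally_compact_Hausdorff_compact_closure_of:
  assumes "locally_compact_space X" "Hausdorff_space X" "openin X U" "x \<in> U"
  obtains V where "openin X V" "x \<in> V" "compactin X (X closure_of V)" "X closure_of V \<subseteq> U"
proof -
  have "neighbourhood_base_of (\<lambda>C. compactin X C \<and> closedin X C) X"
    using assms(1,2) locally_compact_space_neighbourhood_base_closedin by blast
  then obtain V C where V: "openin X V" "x \<in> V" "V \<subseteq> C" "C \<subseteq> U" "compactin X C" "closedin X C"
    using assms(3,4) unfolding neighbourhood_base_of by meson
  have "X closure_of V \<subseteq> C" using V(3,6) by (rule closure_of_minimal)
  then have "compactin X (X closure_of V)" using V(5) by (meson closed_compactin closedin_closure_of)
  with \<open>X closure_of V \<subseteq> C\<close> show ?thesis using that[OF V(1,2)] V(4) by blast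
qed

lemma discrete_compact_neighbourhoods:
  assumes X: "locally_compact_space X" "Hausdorff_space X"
    and A: "closedin X A" "normal_space (subtopology X A)"
    and T: "infinite_discrete_closed_in X T"
    and N: "\<And>t. t \<in> T \<Longrightarrow> openin X (N t) \<and> t \<in> N t \<and> N t \<subseteq> A"
  obtains t :: "nat \<Rightarrow> 'a" and V where "inj t" "range t \<subseteq> T" "\<And>n. openin X (V n)" "\<And>n. t n \<in> V n"
    "\<And>n. compactin X (X closure_of V n)" "\<And>n. X closure_of V n \<subseteq> N (t n)"
    "disjoint_family (\<lambda>n. X closure_of V n)" "locally_finite_in X (range (\<lambda>n. X closure_of V n))"
proof -
  have "T \<subseteq> A" using N by blast
  then obtain t :: "nat \<Rightarrow> 'a" and f where t: "inj t" "range t \<subseteq> T"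
    and f: "continuous_map (subtopology X A) euclideanreal f" "\<And>n. f (t n) = real n"
    using Tietze_extension_infinite_discrete_closed[OF A(2)] infinite_discrete_closed_in_subtopology[OF T]
    by metis
  have "\<exists>V. openin X V \<and> t n \<in> V \<and> compactin X (X closure_of V) \<and>
      X closure_of V \<subseteq> N (t n) \<and> (\<forall>x\<in>X closure_of V. \<bar>f x - real n\<bar> < 1/3)" for n
  proof -
    let ?P = "{x \<in> topspace (subtopology X A). f x \<in> ball (real n) (1/3)}"
    have "openin (subtopology X A) ?P" using f(1) by (rule openin_continuous_map_preimage) simp
    then obtain U where U: "openin X U" "?P = U \<inter> A" by (auto simp: openin_subtopology)
    have Nt: "openin X (N (t n))" "t n \<in> N (t n)" "N (t n) \<subseteq> A" using N t(2) by blast+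
    then have "t n \<in> ?P" using f(2) closedin_subset[OF A(1)] by auto
    then have "t n \<in> U \<inter> N (t n)" using U(2) Nt(2) by blast
    then obtain V where V: "openin X V" "t n \<in> V" "compactin X (X closure_of V)"
      "X closure_of V \<subseteq> U \<inter> N (t n)"
      using locally_compact_Hausdorff_compact_closure_of[OF X openin_Int[OF U(1) Nt(1)]] by blast
    have "X closure_of V \<subseteq> ?P" unfolding U(2) using V(4) Nt(3) by blast
    then have "\<forall>x\<in>X closure_of V. \<bar>f x - real n\<bar> < 1/3" by (auto simp: dist_real_def abs_minus_commute)
    then show ?thesis using V by blast
  qed
  then obtain V where V: "\<And>n. openin X (V n)" "\<And>n. t n \<in> V n" "\<And>n. compactin X (X closure_of V n)"
    "\<And>n. X closure_of V n \<subseteq> N (t n)" "\<And>n x. x \<in> X closure_of V n \<Longrightarrow> \<bar>f x - real n\<bar> < 1/3"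
    by metis
  moreover have "X closure_of V n \<subseteq> A" for n using V(4) N t(2) by blast
  ultimately show ?thesis
    using that[OF t, of V] locally_finite_in_separated_by_function[OF A(1) f(1), of "\<lambda>n. X closure_of V n"]
    by blast
qed

section \<open>Local size of the homeomorphism groups\<close>

definition nondiscrete_Homeo_at :: "'a topology \<Rightarrow> 'a \<Rightarrow> bool" where
  "nondiscrete_Homeo_at X t \<longleftrightarrow>
     (\<forall>V. neighbourhood_of X V t \<and> compactin X (X closure_of V) \<longrightarrow>
        Homeo_top X (X closure_of V) \<noteq> discrete_topology (Homeo X (X closure_of V)))"

definition nowhere_locally_compact_Homeo :: "'a topology \<Rightarrow> bool" where
  "nowhere_locally_compact_Homeo X \<longleftrightarrow>
     (\<forall>U. openin X U \<and> U \<noteq> {} \<and> compactin X (X closure_of U) \<longrightarrow>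
        \<not> locally_compact_space (Homeo_top X (X closure_of U)))"

lemma nowhere_locally_compact_imp_nondiscrete_Homeo_at:
  assumes "nowhere_locally_compact_Homeo X"
  shows "nondiscrete_Homeo_at X t"
  unfolding nondiscrete_Homeo_at_def
proof (intro allI impI notI)
  fix V assume V: "neighbourhood_of X V t \<and> compactin X (X closure_of V)"
    and discrete: "Homeo_top X (X closure_of V) = discrete_topology (Homeo X (X closure_of V))"
  obtain W where W: "openin X W" "t \<in> W" "W \<subseteq> V" using V by (auto simp: neighbourhood_of_def)
  have subset: "X closure_of W \<subseteq> X closure_of V" using W(3) by (rule closure_of_mono)
  then have "compactin X (X closure_of W)" using V by (meson closed_compactin closedin_closure_of)
  then have "\<not> locally_compact_space (Homeo_top X (X closure_of W))"
    using assms W unfolding nowhere_locally_compact_Homeo_def by blast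
  then show False
    using Homeo_top_discrete_mono[OF subset discrete] by (simp add: locally_compact_space_discrete_topology)
qed

lemma nowhere_locally_compact_imp_ex_not_locally_compact_Homeo_top:
  assumes "locally_compact_space X" "Hausdorff_space X" "topspace X \<noteq> {}" "nowhere_locally_compact_Homeo X"
  shows "\<exists>M. compactin X M \<and> \<not> locally_compact_space (Homeo_top X M)"
proof -
  obtain x where "x \<in> topspace X" using assms(3) by blast
  then obtain U where "openin X U" "x \<in> U" "compactin X (X closure_of U)"
    using locally_compact_Hausdorff_compact_closure_of[OF assms(1,2) openin_topspace] by metis
  then show ?thesis using assms(4) unfolding nowhere_locally_compact_Homeo_def by blast
qed

theorem not_Homeo_family_ACP_if_nondiscrete:
  assumes X: "locally_compact_space X" "Hausdorff_space X"
    and M: "compactin X M" "metrizable_space (subtopology X M)" "\<not> locally_compact_space (Homeo_top X M)"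
    and A: "closedin X A" "metrizable_space (subtopology X A)"
    and T: "T \<subseteq> X interior_of A" "infinite_discrete_closed_in X T" "\<And>t. t \<in> T \<Longrightarrow> nondiscrete_Homeo_at X t"
  shows "\<not> Homeo_family_ACP X"
proof -
  have "infinite_discrete_closed_in X (T - M)"
    using T(2) M(1) by (rule infinite_discrete_closed_in_diff_compactin)
  moreover have "openin X (X interior_of A - M) \<and> t \<in> X interior_of A - M \<and> X interior_of A - M \<subseteq> A"
    if "t \<in> T - M" for t
    using that T(1) interior_of_subset[of X A]
      openin_diff[OF openin_interior_of compactin_imp_closedin[OF X(2) M(1)]] by blast
  ultimately obtain t :: "nat \<Rightarrow> 'a" and V where t: "range t \<subseteq> T - M"
    and V: "\<And>n. openin X (V n)" "\<And>n. t n \<in> V n" "\<And>n. compactin X (X closure_of V n)"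
      "\<And>n. X closure_of V n \<subseteq> X interior_of A - M"
    and family: "disjoint_family (\<lambda>n. X closure_of V n)"
      "locally_finite_in X (range (\<lambda>n. X closure_of V n))"
    using discrete_compact_neighbourhoods[OF X A(1) metrizable_imp_normal_space[OF A(2)],
        of "T - M" "\<lambda>_. X interior_of A - M"] by metis
  have nonempty: "X closure_of V n \<noteq> {}" for n
    using V(2) closure_of_subset[OF openin_subset[OF V(1)]] by blast
  show ?thesis
  proof (rule not_Homeo_family_ACP[OF X M V(3)])
    show "metrizable_space (subtopology X (X closure_of V n))" for n
    proof -
      have "X closure_of V n \<subseteq> A" using V(4)[of n] interior_of_subset[of X A] by blast
      with A(2) show ?thesis by (rule metrizable_space_subtopology_mono)
    qed
    show "Homeo_top X (X closure_of V n) \<noteq> discrete_topology (Homeo X (X closure_of V n))" for n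
    proof -
      have "neighbourhood_of X (V n) (t n)"
        unfolding neighbourhood_of_def using V(1,2)[of n] openin_subset[OF V(1)] by blast
      then show ?thesis using T(3)[of "t n"] t V(3) unfolding nondiscrete_Homeo_at_def by blast
    qed
    show "X closure_of V n \<inter> M = {}" for n using V(4) by blast
    show "finite {n. X closure_of V n \<inter> C \<noteq> {}}" if "compactin X C" for C
      using family nonempty that by (rule finite_disjoint_locally_finite_compactin)
  qed
qed

section \<open>Locally metrizable spaces\<close>

lemma metrizable_imp_locally_metrizable_space:
  "metrizable_space X \<Longrightarrow> locally_metrizable_space X"
  unfolding locally_metrizable_space_def by (metis openin_topspace subtopology_topspace)

lemma locally_metrizable_imp_second_countable_nhds:
  assumes X: "locally_compact_space X" "Hausdorff_space X" "locally_metrizable_space X"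
    and x: "x \<in> topspace X"
  obtains V where "openin X V" "x \<in> V" "second_countable (subtopology X V)"
proof -
  obtain N where N: "openin X N" "x \<in> N" "metrizable_space (subtopology X N)"
    using X(3) x unfolding locally_metrizable_space_def by blast
  obtain V where V: "openin X V" "x \<in> V" "compactin X (X closure_of V)" "X closure_of V \<subseteq> N"
    using locally_compact_Hausdorff_compact_closure_of[OF X(1,2) N(1,2)] .
  have "second_countable (subtopology (subtopology X (X closure_of V)) V)"
    using compactin_metrizable_imp_second_countable[OF V(3,4) N(3)] by (rule second_countable_subtopology)
  moreover have "V \<subseteq> X closure_of V" using V(1) by (simp add: closure_of_subset openin_subset)
  ultimately show ?thesis
    using that V(1,2) by (simp add: subtopology_subtopology Int_absorb1)
qed

lemma compactin_locally_metrizable_imp_metrizable: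
  assumes X: "locally_compact_space X" "Hausdorff_space X" "locally_metrizable_space X"
    and M: "compactin X M"
  shows "metrizable_space (subtopology X M)"
proof -
  have "\<exists>V. openin X V \<and> x \<in> V \<and> second_countable (subtopology X V)" if "x \<in> M" for x
    using locally_metrizable_imp_second_countable_nhds[OF X] compactin_subset_topspace[OF M] that
    by (metis subsetD)
  then obtain V where V: "\<And>x. x \<in> M \<Longrightarrow> openin X (V x) \<and> x \<in> V x \<and> second_countable (subtopology X (V x))"
    by metis
  then obtain F where F: "finite F" "F \<subseteq> M" "M \<subseteq> (\<Union>x\<in>F. V x)"
    using compactin_finite_pointwise_cover[OF M, of V] by metis
  have "second_countable (subtopology X M)"
  proof (rule second_countable_open_cover)
    show "countable ((\<lambda>x. V x \<inter> M) ` F)" using F(1) by (simp add: countable_finite)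
    show "topspace (subtopology X M) \<subseteq> \<Union>((\<lambda>x. V x \<inter> M) ` F)" using F(3) by auto
    fix U assume "U \<in> (\<lambda>x. V x \<inter> M) ` F"
    then obtain x where x: "x \<in> M" "U = V x \<inter> M" using F(2) by blast
    then show "openin (subtopology X M) U" using V openin_subtopology by blast
    have "second_countable (subtopology (subtopology X (V x)) M)"
      using V[OF x(1)] second_countable_subtopology by blast
    moreover have "M \<inter> (V x \<inter> M) = V x \<inter> M" by blast
    ultimately show "second_countable (subtopology (subtopology X M) U)"
      using x(2) by (simp add: subtopology_subtopology)
  qed
  moreover have "regular_space X"
    using X(1,2) locally_compact_Hausdorff_imp_regular_space by blast
  ultimately show ?thesis
    using X(2) by (intro Urysohn_metrization regular_space_subtopology Hausdorff_space_subtopology)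
qed

lemma metrizable_disjoint_locally_finite_Union:
  assumes X: "regular_space X" "Hausdorff_space X"
    and K: "\<And>n::nat. closedin X (K n)" "\<And>n. second_countable (subtopology X (K n))"
    and family: "disjoint_family K" "locally_finite_in X (range K)"
  shows "metrizable_space (subtopology X (\<Union>n. K n))"
proof -
  let ?Y = "subtopology X (\<Union>n. K n)"
  have K_open: "openin ?Y (K n)" for n
  proof -
    have "closedin X (\<Union>(K ` (- {n})))"
      using K(1) locally_finite_in_subset[OF family(2), of "K ` (- {n})"]
      by (intro closedin_locally_finite_Union) auto
    then have "openin ?Y ((topspace X - \<Union>(K ` (- {n}))) \<inter> (\<Union>n. K n))"
      by (intro openin_subtopology_Int) blast
    moreover have "(topspace X - \<Union>(K ` (- {n}))) \<inter> (\<Union>n. K n) = K n"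
      using family(1) closedin_subset[OF K(1)] by (fastforce simp: disjoint_family_on_def)
    ultimately show ?thesis by simp
  qed
  have "second_countable ?Y"
  proof (rule second_countable_open_cover[of "range K"])
    fix U assume "U \<in> range K"
    then obtain n where n: "U = K n" by blast
    show "openin ?Y U" using K_open n by simp
    show "second_countable (subtopology ?Y U)"
      using K(2)[of n] n by (simp add: subtopology_subtopology Int_absorb1 UN_upper)
  qed auto
  then show ?thesis
    using X by (intro Urysohn_metrization regular_space_subtopology Hausdorff_space_subtopology)
qed

lemma regular_closed_in_closure_of_open:
  assumes "openin X U"
  shows "regular_closed_in X (X closure_of U)"
  unfolding regular_closed_in_def
proof (rule subset_antisym)
  show "X closure_of (X interior_of (X closure_of U)) \<subseteq> X closure_of U"
    by (simp add: closure_of_minimal interior_of_subset)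
  have "U \<subseteq> X interior_of (X closure_of U)"
    using assms by (simp add: closure_of_subset interior_of_maximal openin_subset)
  then show "X closure_of U \<subseteq> X closure_of (X interior_of (X closure_of U))"
    by (rule closure_of_mono)
qed

lemma regular_closed_in_locally_finite_Union_closure_of:
  assumes "\<And>n::nat. openin X (V n)" "locally_finite_in X (range (\<lambda>n. X closure_of V n))"
  shows "regular_closed_in X (\<Union>n. X closure_of V n)"
proof -
  have "V n \<subseteq> X closure_of V n" for n
    using assms(1) by (simp add: closure_of_subset openin_subset)
  moreover have "closedin X (\<Union>n. X closure_of V n)"
    using assms(2) by (intro closedin_locally_finite_Union) auto
  ultimately have "X closure_of (\<Union>n. V n) \<subseteq> (\<Union>n. X closure_of V n)"
    by (intro closure_of_minimal UN_mono) auto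
  moreover have "(\<Union>n. X closure_of V n) \<subseteq> X closure_of (\<Union>n. V n)"
    by (intro UN_least closure_of_mono) blast
  moreover have "openin X (\<Union>n. V n)" using assms(1) by blast
  ultimately show ?thesis
    using regular_closed_in_closure_of_open by (metis subset_antisym)
qed

lemma metrizable_regular_closed_in_around_discrete_set:
  assumes X: "locally_compact_space X" "Hausdorff_space X" "normal_space X" "locally_metrizable_space X"
    and T: "infinite_discrete_closed_in X T"
  obtains A S where "regular_closed_in X A" "sigma_compact_in X A" "metrizable_space (subtopology X A)"
    "S \<subseteq> X interior_of A" "S \<subseteq> T" "infinite_discrete_closed_in X S"
proof -
  have "T \<subseteq> topspace X" using T by (simp add: infinite_discrete_closed_in_iff)
  then have "\<forall>t\<in>T. \<exists>N. openin X N \<and> t \<in> N \<and> metrizable_space (subtopology X N)"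
    using X(4) unfolding locally_metrizable_space_def by blast
  then obtain N where N: "\<And>t. t \<in> T \<Longrightarrow> openin X (N t) \<and> t \<in> N t \<and> metrizable_space (subtopology X (N t))"
    by metis
  have "normal_space (subtopology X (topspace X))" using X(3) by simp
  moreover have "openin X (N t) \<and> t \<in> N t \<and> N t \<subseteq> topspace X" if "t \<in> T" for t
    using N[OF that] openin_subset by blast
  ultimately obtain t :: "nat \<Rightarrow> 'a" and V where t: "inj t" "range t \<subseteq> T"
    and V: "\<And>n. openin X (V n)" "\<And>n. t n \<in> V n" "\<And>n. compactin X (X closure_of V n)"
      "\<And>n. X closure_of V n \<subseteq> N (t n)"
    and family: "disjoint_family (\<lambda>n. X closure_of V n)"
      "locally_finite_in X (range (\<lambda>n. X closure_of V n))"
    using discrete_compact_neighbourhoods[OF X(1,2) closedin_topspace _ T] by metis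
  define A where "A = (\<Union>n. X closure_of V n)"
  have VA: "(\<Union>n. V n) \<subseteq> A"
    unfolding A_def using V(1) by (intro UN_mono closure_of_subset openin_subset) auto
  have "regular_closed_in X A"
    unfolding A_def using V(1) family(2) by (rule regular_closed_in_locally_finite_Union_closure_of)
  moreover have "sigma_compact_in X A"
    unfolding sigma_compact_in_def A_def using V(3) by (intro exI[of _ "\<lambda>n. X closure_of V n"]) simp
  moreover have "metrizable_space (subtopology X A)"
    unfolding A_def
  proof (rule metrizable_disjoint_locally_finite_Union[OF _ X(2) closedin_closure_of _ family])
    show "regular_space X" using X(1,2) locally_compact_Hausdorff_imp_regular_space by blast
    show "second_countable (subtopology X (X closure_of V n))" for n
      using compactin_metrizable_imp_second_countable[OF V(3,4)] N t(2) by blast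
  qed
  moreover have "range t \<subseteq> X interior_of A"
    using V(2) interior_of_maximal[OF VA] V(1) by blast
  moreover have "infinite_discrete_closed_in X (range t)"
    using infinite_discrete_closed_in_subset[OF T t(2)] t(1) by (simp add: finite_image_iff)
  ultimately show ?thesis using that t(2) by blast
qed

lemma metrizable_noncompact_imp_infinite_discrete_closed:
  assumes "metrizable_space X" "\<not> compact_space X"
  shows "\<exists>T. infinite_discrete_closed_in X T"
proof -
  obtain M d where "Metric_space M d" and X: "X = Metric_space.mtopology M d"
    using assms(1) by (auto simp: metrizable_space_def)
  then interpret Metric_space M d by simp
  show ?thesis
    using assms(2) X compact_space_eq_Bolzano_Weierstrass by (auto simp: infinite_discrete_closed_in_iff)
qed

section \<open>Radial homeomorphisms of the unit ball\<close>

lemma continuous_map_into_Euclidean_space_iff: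
  "continuous_map X (Euclidean_space n) f \<longleftrightarrow>
     f \<in> topspace X \<rightarrow> topspace (Euclidean_space n) \<and> (\<forall>i. continuous_map X euclideanreal (\<lambda>x. f x i))"
  by (auto simp: Euclidean_space_def continuous_map_in_subtopology continuous_map_componentwise_UNIV)

lemma continuous_map_Euclidean_space_coordinate:
  "continuous_map X (Euclidean_space n) f \<Longrightarrow> continuous_map X euclideanreal (\<lambda>x. f x i)"
  by (simp add: continuous_map_into_Euclidean_space_iff)

lemma limitin_Euclidean_space_iff:
  "limitin (Euclidean_space n) f l F \<longleftrightarrow> l \<in> topspace (Euclidean_space n) \<and>
     (\<forall>\<^sub>F x in F. f x \<in> topspace (Euclidean_space n)) \<and> (\<forall>i. ((\<lambda>x. f x i) \<longlongrightarrow> l i) F)"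
  by (simp add: Euclidean_space_def limitin_subtopology limitin_componentwise)

definition l1_norm :: "nat \<Rightarrow> (nat \<Rightarrow> real) \<Rightarrow> real" where
  "l1_norm n p = (\<Sum>i<n. \<bar>p i\<bar>)"

definition l1_cball :: "nat \<Rightarrow> (nat \<Rightarrow> real) set" where
  "l1_cball n = {p \<in> topspace (Euclidean_space n). l1_norm n p \<le> 1}"

definition l1_ball :: "nat \<Rightarrow> (nat \<Rightarrow> real) set" where
  "l1_ball n = {p \<in> topspace (Euclidean_space n). l1_norm n p < 1}"

lemma l1_norm_nonneg [simp]: "0 \<le> l1_norm n p"
  by (simp add: l1_norm_def sum_nonneg)

lemma l1_norm_zero [simp]: "l1_norm n (\<lambda>i. 0) = 0"
  by (simp add: l1_norm_def)

lemma l1_norm_divide: "l1_norm n (\<lambda>i. p i / c) = l1_norm n p / \<bar>c\<bar>"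
  by (simp add: l1_norm_def sum_divide_distrib)

lemma l1_norm_axis: "0 < n \<Longrightarrow> l1_norm n (\<lambda>i. if i = 0 then c else 0) = \<bar>c\<bar>"
  by (simp add: l1_norm_def if_distrib cong: if_cong)

lemma abs_le_l1_norm:
  assumes "p \<in> topspace (Euclidean_space n)"
  shows "\<bar>p i\<bar> \<le> l1_norm n p"
proof (cases "i < n")
  case True
  then show ?thesis unfolding l1_norm_def by (intro member_le_sum) auto
next
  case False
  then show ?thesis using assms by (simp add: topspace_Euclidean_space)
qed

lemma continuous_map_l1_norm:
  "continuous_map X (Euclidean_space n) f \<Longrightarrow> continuous_map X euclideanreal (\<lambda>x. l1_norm n (f x))"
  unfolding l1_norm_def by (intro continuous_intros continuous_map_Euclidean_space_coordinate) auto

lemma l1_cball_subset: "l1_cball n \<subseteq> topspace (Euclidean_space n)"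
  by (auto simp: l1_cball_def)

lemma openin_l1_ball: "openin (Euclidean_space n) (l1_ball n)"
proof -
  have "openin (Euclidean_space n) {p \<in> topspace (Euclidean_space n). l1_norm n p \<in> {..<1}}"
    by (rule openin_continuous_map_preimage[OF continuous_map_l1_norm]) simp_all
  then show ?thesis by (simp add: l1_ball_def)
qed

lemma compactin_l1_cball: "compactin (Euclidean_space n) (l1_cball n)"
proof -
  have "closedin (Euclidean_space n) {p \<in> topspace (Euclidean_space n). l1_norm n p \<in> {..1}}"
    by (rule closedin_continuous_map_preimage[OF continuous_map_l1_norm]) simp_all
  then have "closedin (powertop_real UNIV) (l1_cball n)"
    using closedin_Euclidean_space[of n]
    by (simp add: l1_cball_def Euclidean_space_def closedin_closed_subtopology)
  moreover have "l1_cball n \<subseteq> Pi\<^sub>E UNIV (\<lambda>_. {-1..1})"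
  proof
    fix p assume p: "p \<in> l1_cball n"
    have "\<bar>p i\<bar> \<le> 1" for i
      using abs_le_l1_norm[of p n i] p by (simp add: l1_cball_def)
    then show "p \<in> Pi\<^sub>E UNIV (\<lambda>_. {-1..1})"
      by (simp add: PiE_iff abs_le_iff minus_le_iff)
  qed
  moreover have "compactin (powertop_real UNIV) (Pi\<^sub>E UNIV (\<lambda>_. {-1..1}))"
    by (simp add: compactin_PiE)
  ultimately have "compactin (powertop_real UNIV) (l1_cball n)"
    using closed_compactin by blast
  then show ?thesis
    using l1_cball_subset by (simp add: Euclidean_space_def compactin_subtopology)
qed

lemma Euclidean_space_open_contains_l1_cball:
  assumes S: "openin (Euclidean_space n) S" "c \<in> S"
  obtains \<epsilon> where "0 < \<epsilon>" "\<And>p. p \<in> l1_cball n \<Longrightarrow> (\<lambda>i. c i + \<epsilon> * p i) \<in> S"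
proof (rule ccontr)
  assume no: "\<not> thesis"
  have c: "c \<in> topspace (Euclidean_space n)" using S openin_subset by blast
  have "\<exists>p\<in>l1_cball n. (\<lambda>i. c i + inverse (real (Suc m)) * p i) \<notin> S" for m
    using no that[of "inverse (real (Suc m))"] by auto
  then obtain p where p: "\<And>m. p m \<in> l1_cball n" "\<And>m. (\<lambda>i. c i + inverse (real (Suc m)) * p m i) \<notin> S"
    by metis
  have "(\<lambda>m. c i + inverse (real (Suc m)) * p m i) \<longlonglongrightarrow> c i" for i
  proof -
    have "\<bar>p m i\<bar> \<le> 1" for m
      using abs_le_l1_norm[of "p m" n i] p(1)[of m] by (auto simp: l1_cball_def)
    then have "(\<lambda>m. inverse (real (Suc m)) * p m i) \<longlonglongrightarrow> 0"
      by (intro Lim_null_comparison[OF _ LIMSEQ_inverse_real_of_nat])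
        (simp add: abs_mult mult_left_le)
    then show ?thesis using tendsto_add[OF tendsto_const] by fastforce
  qed
  moreover have "(\<lambda>i. c i + inverse (real (Suc m)) * p m i) \<in> topspace (Euclidean_space n)" for m
    using c p(1)[of m] by (simp add: l1_cball_def topspace_Euclidean_space)
  ultimately have "limitin (Euclidean_space n) (\<lambda>m i. c i + inverse (real (Suc m)) * p m i) c sequentially"
    using c by (simp add: limitin_Euclidean_space_iff)
  then have "\<forall>\<^sub>F m in sequentially. (\<lambda>i. c i + inverse (real (Suc m)) * p m i) \<in> S"
    using S by (rule limitinD)
  then show False using p(2) by simp
qed

definition radial_contraction :: "nat \<Rightarrow> real \<Rightarrow> (nat \<Rightarrow> real) \<Rightarrow> nat \<Rightarrow> real" where
  "radial_contraction n k p = (\<lambda>i. p i / (1 + k * (1 - l1_norm n p)))"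

definition radial_expansion :: "nat \<Rightarrow> real \<Rightarrow> (nat \<Rightarrow> real) \<Rightarrow> nat \<Rightarrow> real" where
  "radial_expansion n k p = (\<lambda>i. p i / ((1 + k * l1_norm n p) / (1 + k)))"

lemma radial_contraction_cball:
  assumes "0 \<le> k" "p \<in> l1_cball n"
  shows "radial_contraction n k p \<in> l1_cball n"
    "l1_norm n (radial_contraction n k p) = l1_norm n p / (1 + k * (1 - l1_norm n p))"
proof -
  have ge1: "1 \<le> 1 + k * (1 - l1_norm n p)"
    using assms by (simp add: l1_cball_def)
  then show norm: "l1_norm n (radial_contraction n k p) = l1_norm n p / (1 + k * (1 - l1_norm n p))"
    by (simp add: radial_contraction_def l1_norm_divide)
  have "l1_norm n p \<le> 1 + k * (1 - l1_norm n p)"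
    using ge1 assms(2) by (simp add: l1_cball_def)
  then show "radial_contraction n k p \<in> l1_cball n"
    using assms(2) norm ge1 by (simp add: l1_cball_def topspace_Euclidean_space radial_contraction_def)
qed

lemma radial_expansion_cball:
  assumes "0 \<le> k" "p \<in> l1_cball n"
  shows "radial_expansion n k p \<in> l1_cball n"
    "l1_norm n (radial_expansion n k p) = l1_norm n p / ((1 + k * l1_norm n p) / (1 + k))"
proof -
  have pos: "0 < (1 + k * l1_norm n p) / (1 + k)"
    using assms(1) by (simp add: add_pos_nonneg)
  then show norm: "l1_norm n (radial_expansion n k p) = l1_norm n p / ((1 + k * l1_norm n p) / (1 + k))"
    unfolding radial_expansion_def l1_norm_divide by (simp only: abs_of_pos)
  have "l1_norm n p \<le> (1 + k * l1_norm n p) / (1 + k)"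
    using assms by (simp add: l1_cball_def field_simps)
  then have "l1_norm n (radial_expansion n k p) \<le> 1"
    unfolding norm using pos by (simp only: divide_le_eq_1_pos)
  then show "radial_expansion n k p \<in> l1_cball n"
    using assms(2) by (simp add: l1_cball_def topspace_Euclidean_space radial_expansion_def)
qed

lemma homeomorphic_maps_radial:
  assumes k: "0 \<le> k"
  shows "homeomorphic_maps (subtopology (Euclidean_space n) (l1_cball n))
           (subtopology (Euclidean_space n) (l1_cball n)) (radial_contraction n k) (radial_expansion n k)"
  unfolding homeomorphic_maps_def
proof (intro conjI ballI)
  let ?B = "subtopology (Euclidean_space n) (l1_cball n)"
  have topspace: "topspace ?B = l1_cball n" using l1_cball_subset by auto
  have id: "continuous_map ?B (Euclidean_space n) (\<lambda>p. p)"
    using continuous_map_id[of "Euclidean_space n"] by (simp add: id_def continuous_map_from_subtopology)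
  have pos: "0 < 1 + k * (1 - l1_norm n p)" "0 < 1 + k * l1_norm n p" if "p \<in> l1_cball n" for p
    using that k by (auto simp: l1_cball_def add_pos_nonneg)
  have "continuous_map ?B euclideanreal (\<lambda>p. p i / (1 + k * (1 - l1_norm n p)))"
    "continuous_map ?B euclideanreal (\<lambda>p. p i / ((1 + k * l1_norm n p) / (1 + k)))" for i
    using pos k
    by (intro continuous_intros continuous_map_Euclidean_space_coordinate[OF id]
          continuous_map_l1_norm[OF id]; force simp: topspace)+
  then show "continuous_map ?B ?B (radial_contraction n k)" "continuous_map ?B ?B (radial_expansion n k)"
    using radial_contraction_cball(1)[OF k] radial_expansion_cball(1)[OF k]
    by (auto simp: continuous_map_in_subtopology continuous_map_into_Euclidean_space_iff topspace
        radial_contraction_def radial_expansion_def subsetD[OF l1_cball_subset])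
  fix p assume "p \<in> topspace ?B"
  then have p: "p \<in> l1_cball n" by (simp add: topspace)
  let ?s = "l1_norm n p"
  have "(1 + k * (?s / (1 + k * (1 - ?s)))) / (1 + k) = 1 / (1 + k * (1 - ?s))"
    using k pos(1)[OF p] by (simp add: divide_simps) (simp add: algebra_simps)
  then show "radial_expansion n k (radial_contraction n k p) = p"
    unfolding radial_expansion_def radial_contraction_cball(2)[OF k p]
    using pos(1)[OF p] by (simp add: radial_contraction_def fun_eq_iff)
  have "1 + k * (1 - ?s / ((1 + k * ?s) / (1 + k))) = (1 + k) / (1 + k * ?s)"
    using pos(2)[OF p] by (simp add: divide_simps) (simp add: algebra_simps)
  then show "radial_contraction n k (radial_expansion n k p) = p"
    unfolding radial_contraction_def radial_expansion_cball(2)[OF k p]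
    using k pos(2)[OF p] by (simp add: radial_expansion_def fun_eq_iff)
qed

lemma limitin_radial_contraction:
  assumes "p \<in> l1_ball n"
  shows "limitin (Euclidean_space n) (\<lambda>k. radial_contraction n (real k) p) (\<lambda>i. 0) sequentially"
proof -
  have p: "p \<in> topspace (Euclidean_space n)" and "0 < 1 - l1_norm n p"
    using assms by (auto simp: l1_ball_def)
  then have "filterlim (\<lambda>k. 1 + real k * (1 - l1_norm n p)) at_top sequentially"
    by (intro filterlim_tendsto_add_at_top[OF tendsto_const] filterlim_real_sequentially
        filterlim_at_top_mult_tendsto_pos[OF tendsto_const])
  then have "(\<lambda>k. p i / (1 + real k * (1 - l1_norm n p))) \<longlonglongrightarrow> 0" for i
    by (rule tendsto_divide_0[OF tendsto_const filterlim_at_top_imp_at_infinity])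
  then show ?thesis
    using p by (simp add: limitin_Euclidean_space_iff radial_contraction_def topspace_Euclidean_space)
qed

section \<open>Locally Euclidean spaces\<close>

lemma continuous_map_extend_by_id:
  assumes D: "closedin X D" and V: "openin X V" "V \<subseteq> D"
    and h: "continuous_map (subtopology X D) X h" "\<And>x. x \<in> D - V \<Longrightarrow> h x = x"
  shows "continuous_map X X (\<lambda>x. if x \<in> D then h x else x)"
proof (rule continuous_map_cases_alt)
  have "X closure_of {x \<in> topspace X. x \<in> D} \<subseteq> D"
    using D by (intro closure_of_minimal) auto
  then show "continuous_map (subtopology X (X closure_of {x \<in> topspace X. x \<in> D})) X h"
    using h(1) by (rule continuous_map_from_subtopology_mono[rotated])
  show "continuous_map (subtopology X (X closure_of {x \<in> topspace X. x \<notin> D})) X (\<lambda>x. x)"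
    using continuous_map_from_subtopology[OF continuous_map_id] by (simp add: id_def)
  fix x assume x: "x \<in> X frontier_of {x \<in> topspace X. x \<in> D}"
  have "V \<subseteq> X interior_of {x \<in> topspace X. x \<in> D}"
    using V openin_subset by (intro interior_of_maximal) auto
  then show "h x = x"
    using x \<open>X closure_of _ \<subseteq> D\<close> h(2) by (auto simp: frontier_of_def)
qed

lemma homeomorphic_maps_extend_by_id:
  assumes D: "closedin X D" and V: "openin X V" "V \<subseteq> D"
    and h: "homeomorphic_maps (subtopology X D) (subtopology X D) h g" "\<And>x. x \<in> D - V \<Longrightarrow> h x = x"
  shows "homeomorphic_maps X X (\<lambda>x. if x \<in> D then h x else x) (\<lambda>x. if x \<in> D then g x else x)"
proof -
  have "topspace (subtopology X D) = D" using closedin_subset[OF D] by auto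
  then have "continuous_map (subtopology X D) X h" "continuous_map (subtopology X D) X g"
    and h_D: "\<And>x. x \<in> D \<Longrightarrow> h x \<in> D \<and> g (h x) = x" and g_D: "\<And>x. x \<in> D \<Longrightarrow> g x \<in> D \<and> h (g x) = x"
    using h(1) by (auto simp: homeomorphic_maps_def continuous_map_in_subtopology)
  moreover have "g x = x" if "x \<in> D - V" for x
    using h(2)[OF that] h_D[of x] that by simp
  ultimately show ?thesis
    unfolding homeomorphic_maps_def using h(2)
    by (auto intro: continuous_map_extend_by_id[OF D V])
qed

lemma homeomorphic_maps_Euclidean_affine:
  assumes "c \<in> topspace (Euclidean_space n)" "\<epsilon> \<noteq> 0"
  shows "homeomorphic_maps (Euclidean_space n) (Euclidean_space n)
           (\<lambda>p i. c i + \<epsilon> * p i) (\<lambda>q i. (q i - c i) / \<epsilon>)"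
proof -
  have id: "continuous_map (Euclidean_space n) (Euclidean_space n) (\<lambda>p. p)"
    using continuous_map_id[of "Euclidean_space n"] by (simp add: id_def)
  have "continuous_map (Euclidean_space n) euclideanreal (\<lambda>p. c i + \<epsilon> * p i)"
    "continuous_map (Euclidean_space n) euclideanreal (\<lambda>q. (q i - c i) / \<epsilon>)" for i
    using assms(2) by (intro continuous_intros continuous_map_Euclidean_space_coordinate[OF id]; simp)+
  then show ?thesis
    using assms
    by (auto simp: homeomorphic_maps_def continuous_map_into_Euclidean_space_iff topspace_Euclidean_space)
qed

lemma locally_euclidean_chart_at:
  assumes X: "locally_euclidean_space X" and N: "openin X N" "x \<in> N"
  obtains n V \<psi> \<phi> where "openin X V" "homeomorphic_maps (Euclidean_space n) (subtopology X V) \<psi> \<phi>"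
    "\<psi> (\<lambda>i. 0) = x" "\<psi> ` l1_cball n \<subseteq> N"
proof -
  have "x \<in> topspace X" using N openin_subset by blast
  then obtain V n where V: "openin X V" "x \<in> V" "subtopology X V homeomorphic_space Euclidean_space n"
    using X unfolding locally_euclidean_space_def by blast
  then obtain \<psi> \<phi> where chart: "homeomorphic_maps (Euclidean_space n) (subtopology X V) \<psi> \<phi>"
    unfolding homeomorphic_space_sym[of "subtopology X V"] by (auto simp: homeomorphic_space_def)
  have topspace: "topspace (subtopology X V) = V" using openin_subset[OF V(1)] by auto
  have c: "\<phi> x \<in> topspace (Euclidean_space n)" "\<psi> (\<phi> x) = x"
    using chart V(2) topspace by (auto simp: homeomorphic_maps_def continuous_map_def)
  have "continuous_map (Euclidean_space n) X \<psi>"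
    using chart by (auto simp: homeomorphic_maps_def continuous_map_in_subtopology)
  then have "openin (Euclidean_space n) {p \<in> topspace (Euclidean_space n). \<psi> p \<in> N}"
    using N(1) by (rule openin_continuous_map_preimage)
  moreover have "\<phi> x \<in> {p \<in> topspace (Euclidean_space n). \<psi> p \<in> N}" using c N(2) by simp
  ultimately obtain \<epsilon> where \<epsilon>: "0 < \<epsilon>" "\<forall>p\<in>l1_cball n. \<psi> (\<lambda>i. \<phi> x i + \<epsilon> * p i) \<in> N"
    by (rule Euclidean_space_open_contains_l1_cball) blast
  have "homeomorphic_maps (Euclidean_space n) (subtopology X V)
      (\<psi> \<circ> (\<lambda>p i. \<phi> x i + \<epsilon> * p i)) ((\<lambda>q i. (q i - \<phi> x i) / \<epsilon>) \<circ> \<phi>)"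
    using homeomorphic_maps_Euclidean_affine[OF c(1)] \<epsilon>(1) chart by (intro homeomorphic_maps_compose) auto
  then show ?thesis
    using that[OF V(1)] c(2) \<epsilon>(2) by (auto simp: image_subset_iff)
qed

lemma Homeo_chart_radial_contraction:
  assumes X: "Hausdorff_space X" and V: "openin X V"
    and chart: "homeomorphic_maps (Euclidean_space n) (subtopology X V) \<psi> \<phi>" and k: "0 \<le> k"
  shows "(\<lambda>x. if x \<in> \<psi> ` l1_cball n then \<psi> (radial_contraction n k (\<phi> x)) else x)
           \<in> Homeo X (\<psi> ` l1_cball n)"
proof -
  let ?D = "\<psi> ` l1_cball n" and ?B = "subtopology (Euclidean_space n) (l1_cball n)"
  have topspace: "topspace (subtopology X V) = V" using openin_subset[OF V] by auto
  have \<psi>: "continuous_map (Euclidean_space n) X \<psi>" "\<psi> \<in> topspace (Euclidean_space n) \<rightarrow> V"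
    and \<phi>\<psi>: "\<And>p. p \<in> topspace (Euclidean_space n) \<Longrightarrow> \<phi> (\<psi> p) = p"
    using chart topspace by (auto simp: homeomorphic_maps_def continuous_map_in_subtopology)
  have D: "?D \<subseteq> V" "closedin X ?D"
    using \<psi> l1_cball_subset image_compactin[OF compactin_l1_cball \<psi>(1)] compactin_imp_closedin[OF X]
    by blast+
  have "openin (subtopology X V) (\<psi> ` l1_ball n)"
    using chart openin_l1_ball by (meson homeomorphic_imp_open_map homeomorphic_maps_imp_map open_map_def)
  then have W: "openin X (\<psi> ` l1_ball n)" "\<psi> ` l1_ball n \<subseteq> ?D"
    using V openin_trans_full by (auto simp: l1_ball_def l1_cball_def)
  have "subtopology (subtopology X V) ?D = subtopology X ?D"
    using D(1) by (simp add: subtopology_subtopology Int_absorb1)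
  then have chart_D: "homeomorphic_maps ?B (subtopology X ?D) \<psi> \<phi>"
    using homeomorphic_maps_subtopologies[OF chart, of "l1_cball n" ?D] topspace D(1) l1_cball_subset
    by (simp add: Int_absorb1 Int_absorb2)
  have "homeomorphic_maps (subtopology X ?D) (subtopology X ?D)
      (\<psi> \<circ> (radial_contraction n k \<circ> \<phi>)) (\<psi> \<circ> radial_expansion n k \<circ> \<phi>)"
    using chart_D iffD1[OF homeomorphic_maps_sym chart_D] homeomorphic_maps_radial[OF k]
    by (meson homeomorphic_maps_compose)
  moreover have "(\<psi> \<circ> (radial_contraction n k \<circ> \<phi>)) x = x" if x: "x \<in> ?D - \<psi> ` l1_ball n" for x
  proof -
    obtain p where p: "p \<in> l1_cball n" "x = \<psi> p" using x by blast
    then have "l1_norm n p = 1" using x by (auto simp: l1_cball_def l1_ball_def)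
    then show ?thesis
      using p by (simp add: radial_contraction_def \<phi>\<psi> subsetD[OF l1_cball_subset])
  qed
  ultimately have "homeomorphic_map X X (\<lambda>x. if x \<in> ?D then (\<psi> \<circ> (radial_contraction n k \<circ> \<phi>)) x else x)"
    using homeomorphic_maps_extend_by_id[OF D(2) W] homeomorphic_maps_imp_map by blast
  then show ?thesis by (simp add: Homeo_def o_def cong: if_cong)
qed

lemma chart_collapsing_sequence:
  assumes X: "Hausdorff_space X" and V: "openin X V"
    and chart: "homeomorphic_maps (Euclidean_space n) (subtopology X V) \<psi> \<phi>" and n: "0 < n"
  obtains h :: "nat \<Rightarrow> 'a \<Rightarrow> 'a" and y where "y \<in> topspace X - {\<psi> (\<lambda>i. 0)}"
    "\<And>k. h k \<in> Homeo X (\<psi> ` l1_cball n)" "\<And>k. h k (\<psi> (\<lambda>i. 0)) = \<psi> (\<lambda>i. 0)"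
    "limitin X (\<lambda>k. h k y) (\<psi> (\<lambda>i. 0)) sequentially"
proof -
  have \<psi>: "continuous_map (Euclidean_space n) X \<psi>"
    and \<phi>\<psi>: "\<And>p. p \<in> topspace (Euclidean_space n) \<Longrightarrow> \<phi> (\<psi> p) = p"
    using chart by (auto simp: homeomorphic_maps_def continuous_map_in_subtopology)
  define h where
    "h k x = (if x \<in> \<psi> ` l1_cball n then \<psi> (radial_contraction n (real k) (\<phi> x)) else x)" for k x
  have h\<psi>: "h k (\<psi> p) = \<psi> (radial_contraction n (real k) p)" if "p \<in> l1_cball n" for k p
    using that by (simp add: h_def \<phi>\<psi> subsetD[OF l1_cball_subset])
  define q where "q = (\<lambda>i::nat. if i = 0 then 1/2 else 0 :: real)"
  have q: "q \<in> l1_ball n" "q \<in> l1_cball n"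
    using l1_norm_axis[OF n, of "1/2"] n
    by (auto simp: q_def l1_ball_def l1_cball_def topspace_Euclidean_space)
  have zero: "(\<lambda>i. 0) \<in> l1_cball n" by (simp add: l1_cball_def topspace_Euclidean_space)
  show ?thesis
  proof
    have "\<psi> q \<noteq> \<psi> (\<lambda>i. 0)"
    proof
      assume "\<psi> q = \<psi> (\<lambda>i. 0)"
      then have "q = (\<lambda>i. 0)" using \<phi>\<psi> q(2) zero l1_cball_subset by (metis subsetD)
      then have "q 0 = 0" by simp
      then show False by (simp add: q_def)
    qed
    then show "\<psi> q \<in> topspace X - {\<psi> (\<lambda>i. 0)}"
      using \<psi> subsetD[OF l1_cball_subset q(2)] by (auto simp: continuous_map_def)
    show "h k \<in> Homeo X (\<psi> ` l1_cball n)" for k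
      unfolding h_def[abs_def] by (intro Homeo_chart_radial_contraction[OF X V chart]) simp
    show "h k (\<psi> (\<lambda>i. 0)) = \<psi> (\<lambda>i. 0)" for k
      using h\<psi>[OF zero] by (simp add: radial_contraction_def)
    show "limitin X (\<lambda>k. h k (\<psi> q)) (\<psi> (\<lambda>i. 0)) sequentially"
      using continuous_map_limit[OF \<psi> limitin_radial_contraction[OF q(1)]] by (simp add: h\<psi>[OF q(2)] o_def)
  qed
qed

lemma no_isolated_points_chart_dimension:
  assumes "no_isolated_points X" "openin X V" "homeomorphic_maps (Euclidean_space n) (subtopology X V) \<psi> \<phi>"
  shows "0 < n"
proof (rule ccontr)
  assume "\<not> 0 < n"
  then have "topspace (Euclidean_space n) = {\<lambda>i. 0}" by (auto simp: topspace_Euclidean_space)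
  moreover have "\<psi> ` topspace (Euclidean_space n) = V"
    using homeomorphic_imp_surjective_map[OF homeomorphic_maps_imp_map[OF assms(3)]]
      openin_subset[OF assms(2)] by auto
  ultimately have "V = {\<psi> (\<lambda>i. 0)}" by auto
  then show False using assms(1,2) openin_subset by (fastforce simp: no_isolated_points_def)
qed

theorem locally_euclidean_imp_Homeo_top_not_locally_compact:
  assumes X: "Hausdorff_space X" "locally_euclidean_space X" "no_isolated_points X"
    and U: "openin X U" "U \<noteq> {}"
  shows "\<not> locally_compact_space (Homeo_top X (X closure_of U))"
proof -
  obtain x where x: "x \<in> U" using U(2) by blast
  then have "x \<in> topspace X" using U(1) openin_subset by blast
  then show ?thesis
  proof (rule not_locally_compact_Homeo_top_if_collapsing[OF X(1) _ closure_of_subset_topspace])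
    fix N assume "openin X N" "x \<in> N"
    then have "openin X (N \<inter> U)" "x \<in> N \<inter> U" using U(1) x by auto
    then obtain n V \<psi> \<phi> where V: "openin X V"
      and chart: "homeomorphic_maps (Euclidean_space n) (subtopology X V) \<psi> \<phi>"
      and \<psi>: "\<psi> (\<lambda>i. 0) = x" "\<psi> ` l1_cball n \<subseteq> N \<inter> U"
      using locally_euclidean_chart_at[OF X(2)] by metis
    obtain h :: "nat \<Rightarrow> 'a \<Rightarrow> 'a" and y where "y \<in> topspace X - {x}" "\<And>k. h k \<in> Homeo X (\<psi> ` l1_cball n)"
      "\<And>k. h k x = x" "limitin X (\<lambda>k. h k y) x sequentially"
      using chart_collapsing_sequence[OF X(1) V chart no_isolated_points_chart_dimension[OF X(3) V chart]]
      unfolding \<psi>(1) by metis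
    moreover have "\<psi> ` l1_cball n \<subseteq> N \<inter> X closure_of U"
      using \<psi>(2) closure_of_subset[OF openin_subset[OF U(1)]] by blast
    ultimately show "\<exists>(h :: nat \<Rightarrow> 'a \<Rightarrow> 'a) y. y \<in> topspace X - {x} \<and>
        (\<forall>k. h k \<in> Homeo X (N \<inter> X closure_of U) \<and> h k x = x) \<and> limitin X (\<lambda>k. h k y) x sequentially"
      using Homeo_mono by (metis subsetD)
  qed
qed

section \<open>The chain of implications\<close>

theorem mainTheorem5:
  fixes X :: "'a topology"
  assumes "locally_compact_space X" and "Hausdorff_space X" and "\<not> compact_space X"
  defines "cI \<equiv> metrizable_space X \<and> locally_euclidean_space X \<and> no_isolated_points X"
    and "cII \<equiv> metrizable_space X \<and>
           (\<forall>U. openin X U \<and> U \<noteq> {} \<and> compactin X (X closure_of U) \<longrightarrow>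
                 \<not> locally_compact_space (Homeo_top X (X closure_of U)))"
    and "cIII \<equiv> normal_space X \<and> locally_metrizable_space X \<and>
           (\<exists>M0. compactin X M0 \<and> \<not> locally_compact_space (Homeo_top X M0)) \<and>
           (\<exists>T. infinite_discrete_closed_in X T \<and>
                (\<forall>t\<in>T. \<forall>V. neighbourhood_of X V t \<and> compactin X (X closure_of V) \<longrightarrow>
                   Homeo_top X (X closure_of V) \<noteq> discrete_topology (Homeo X (X closure_of V))))"
    and "cIV \<equiv>
           (\<exists>M0. compactin X M0 \<and> metrizable_space (subtopology X M0) \<and>
                 \<not> locally_compact_space (Homeo_top X M0)) \<and>
           (\<exists>A T. regular_closed_in X A \<and> sigma_compact_in X A \<and>
                  metrizable_space (subtopology X A) \<and>
                  T \<subseteq> X interior_of A \<and> infinite_discrete_closed_in X T \<and>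
                  (\<forall>t\<in>T. \<forall>V. neighbourhood_of X V t \<and> compactin X (X closure_of V) \<longrightarrow>
                     Homeo_top X (X closure_of V) \<noteq> discrete_topology (Homeo X (X closure_of V))))"
    and "cV \<equiv> \<not> Homeo_family_ACP X"
  shows "(cI \<longrightarrow> cII) \<and> (cII \<longrightarrow> cIII) \<and> (cIII \<longrightarrow> cIV) \<and> (cIV \<longrightarrow> cV)"
proof (intro conjI impI)
  show cII if cI
    using that locally_euclidean_imp_Homeo_top_not_locally_compact[OF assms(2)]
    unfolding cI_def cII_def by blast
next
  assume cII
  then have X: "metrizable_space X" "nowhere_locally_compact_Homeo X" "topspace X \<noteq> {}"
    using assms(3) by (auto simp: cII_def nowhere_locally_compact_Homeo_def compact_space_def)
  then show cIII
    unfolding cIII_def nondiscrete_Homeo_at_def[symmetric]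
    using metrizable_imp_normal_space metrizable_imp_locally_metrizable_space
      nowhere_locally_compact_imp_ex_not_locally_compact_Homeo_top[OF assms(1,2)]
      metrizable_noncompact_imp_infinite_discrete_closed[OF _ assms(3)]
      nowhere_locally_compact_imp_nondiscrete_Homeo_at by metis
next
  assume cIII
  then obtain M T where X: "normal_space X" "locally_metrizable_space X"
    and M: "compactin X M" "\<not> locally_compact_space (Homeo_top X M)"
    and T: "infinite_discrete_closed_in X T" "\<forall>t\<in>T. nondiscrete_Homeo_at X t"
    unfolding cIII_def nondiscrete_Homeo_at_def by blast
  obtain A S where "regular_closed_in X A" "sigma_compact_in X A" "metrizable_space (subtopology X A)"
    "S \<subseteq> X interior_of A" "S \<subseteq> T" "infinite_discrete_closed_in X S"
    using metrizable_regular_closed_in_around_discrete_set[OF assms(1,2) X T(1)] .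
  then show cIV
    unfolding cIV_def nondiscrete_Homeo_at_def[symmetric]
    using compactin_locally_metrizable_imp_metrizable[OF assms(1,2) X(2) M(1)] M T(2) by blast
next
  show cV if cIV
    using that not_Homeo_family_ACP_if_nondiscrete[OF assms(1,2)] closedin_closure_of
    unfolding cIV_def cV_def nondiscrete_Homeo_at_def[symmetric] by (metis regular_closed_in_def)
qed

end
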